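(* Under the hypotheses of Theorem 3.4 (real nonzero Banach spaces $X,Y$; $S:X\rightrightarrows X^*$, $T:Y\rightrightarrows Y^*$ maximal monotone of Gossez type (D) with strong representative functions $h_S,h_T$; $A:X\to Y$ linear continuous with $\big(\operatorname{dom}h_T\times\operatorname{pr}_{X^*}(\operatorname{dom}h_S)\big)\cap\big(\operatorname{im}A\times\Delta_{Y^*}^{A^*}\big)\neq\emptyset$), assume additionally $D(\overline S)\subseteq X$. Then, writing $E:=\operatorname{im}A\times\Delta_{Y^*}^{A^*}$, $${}^{ic}(G(T)\times R(S)-E)=\operatorname{ri}(G(T)\times R(S)-E)={}^{ic}(\operatorname{co}G(T)\times\operatorname{co}R(S)-E)=\operatorname{ri}(\operatorname{co}G(T)\times\operatorname{co}R(S)-E)={}^{ic}(\operatorname{dom}h_T\times\operatorname{pr}_{X^*}(\operatorname{dom}h_S)-E)=\operatorname{ri}(\operatorname{dom}h_T\times\operatorname{pr}_{X^*}(\operatorname{dom}h_S)-E).$$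
   Context: $G(M)$, $D(M)$, $R(M)$ graph, domain, range; $\operatorname{co}$ convex hull; $X$ identified with its image in $X^{**}$. Coupling $c(x,x^* )=\langle x^*,x\rangle$. Conjugate of $h$ on $X\times X^*$: $h^*(x^*,x^{**})=\sup_{(x,y^* )}\{\langle x^*,x\rangle+\langle x^{**},y^*\rangle-h(x,y^* )\}$. A representative function of monotone $S$: convex norm-lsc $h_S$ with $h_S\ge c$ and $G(S)\subseteq\{h_S=c\}$; strong if $h_S^*(x^*,x^{**})\ge\langle x^{**},x^*\rangle$ for all. Gossez's closure $\overline S:X^{**}\rightrightarrows X^*$ has graph $\{(x^{**},x^* ):\langle x^{**}-y,x^*-y^*\rangle\ge0\ \forall(y,y^* )\in G(S)\}$; maximal monotone $S$ is of Gossez type (D) if each point of $G(\overline S)$ is the $w^*\times\|\cdot\|_*$-limit of a bounded net in $G(S)$. $\operatorname{im}A=A(X)$; $\Delta_{Y^*}^{A^*}=\{(y^*,A^*y^* )\}$. $\operatorname{icr}D=\{u:\forall x\in\operatorname{aff}(D-D)\ \exists\delta>0\ \forall\lambda\in[0,\delta]:u+\lambda x\in D\}$; ${}^{ic}D=\operatorname{icr}D$ if $\operatorname{aff}D$ closed, else $\emptyset$; $\operatorname{ri}D$ = interior of $D$ relative to $\operatorname{aff}D$ if $\operatorname{aff}D$ closed, else $\emptyset$. *)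

theory Defs
  imports "HOL-Analysis.Analysis"
begin

text \<open>Dual of a real normed space X is modelled by the type of bounded linear
functionals X \<Rightarrow>L real, the bidual by (X \<Rightarrow>L real) \<Rightarrow>L real.
A multivalued operator S : X \<rightrightarrows> X* is identified with its graph G(S).\<close>

type_synonym 'a dual = "'a \<Rightarrow>\<^sub>L real"

definition canon :: "'a::real_normed_vector \<Rightarrow> ('a dual) dual" where
  "canon x = Blinfun (\<lambda>f. blinfun_apply f x)"

definition coupling :: "'a::real_normed_vector \<times> 'a dual \<Rightarrow> real" where
  "coupling z = blinfun_apply (snd z) (fst z)"

definition monotone_op :: "('a::real_normed_vector \<times> 'a dual) set \<Rightarrow> bool" where
  "monotone_op S \<longleftrightarrow>
     (\<forall>(x, u)\<in>S. \<forall>(y, v)\<in>S. 0 \<le> blinfun_apply (u - v) (x - y))"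

definition maximal_monotone :: "('a::real_normed_vector \<times> 'a dual) set \<Rightarrow> bool" where
  "maximal_monotone S \<longleftrightarrow> monotone_op S \<and>
     (\<forall>S'. monotone_op S' \<and> S \<subseteq> S' \<longrightarrow> S' = S)"

definition dom_op :: "('a \<times> 'b) set \<Rightarrow> 'a set" where "dom_op S = fst ` S"
definition ran_op :: "('a \<times> 'b) set \<Rightarrow> 'b set" where "ran_op S = snd ` S"

definition gossez :: "('a::real_normed_vector \<times> 'a dual) set \<Rightarrow> (('a dual) dual \<times> 'a dual) set" where
  "gossez S = {(p, u). \<forall>(y, v)\<in>S. 0 \<le> blinfun_apply (p - canon y) (u - v)}"

text \<open>Gossez type (D): every point of G(S bar) is the weak*-times-norm limit of a
bounded net in G(S). Nets are represented by proper filters on X \<times> X*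
(the eventuality filter of the net); the net is bounded by M.\<close>
definition gossez_D :: "('a::real_normed_vector \<times> 'a dual) set \<Rightarrow> bool" where
  "gossez_D S \<longleftrightarrow> maximal_monotone S \<and>
     (\<forall>(p, u)\<in>gossez S. \<exists>(F :: ('a \<times> 'a dual) filter) (M::real).
        F \<noteq> bot \<and> eventually (\<lambda>z. z \<in> S \<and> norm z \<le> M) F \<and>
        (\<forall>f. ((\<lambda>z. blinfun_apply (canon (fst z)) f) \<longlongrightarrow> blinfun_apply p f) F) \<and>
        ((\<lambda>z. snd z) \<longlongrightarrow> u) F)"

definition convex_ef :: "('c::real_vector \<Rightarrow> ereal) \<Rightarrow> bool" where
  "convex_ef h \<longleftrightarrow> convex {(z, r::real). h z \<le> ereal r}"

definition lsc_ef :: "('c::topological_space \<Rightarrow> ereal) \<Rightarrow> bool" where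
  "lsc_ef h \<longleftrightarrow> (\<forall>r::real. closed {z. h z \<le> ereal r})"

definition edom :: "('c \<Rightarrow> ereal) \<Rightarrow> 'c set" where
  "edom h = {z. h z < \<infinity>}"

definition conjugate :: "('a::real_normed_vector \<times> 'a dual \<Rightarrow> ereal) \<Rightarrow> 'a dual \<times> ('a dual) dual \<Rightarrow> ereal" where
  "conjugate h = (\<lambda>(u, p). SUP z. ereal (blinfun_apply u (fst z) + blinfun_apply p (snd z)) - h z)"

definition representative :: "('a::real_normed_vector \<times> 'a dual) set \<Rightarrow> ('a \<times> 'a dual \<Rightarrow> ereal) \<Rightarrow> bool" where
  "representative S h \<longleftrightarrow> convex_ef h \<and> lsc_ef h \<and>
     (\<forall>z. ereal (coupling z) \<le> h z) \<and> S \<subseteq> {z. h z = ereal (coupling z)}"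

definition strong_representative :: "('a::real_normed_vector \<times> 'a dual) set \<Rightarrow> ('a \<times> 'a dual \<Rightarrow> ereal) \<Rightarrow> bool" where
  "strong_representative S h \<longleftrightarrow> representative S h \<and>
     (\<forall>u p. ereal (blinfun_apply p u) \<le> conjugate h (u, p))"

definition adjoint :: "('a::real_normed_vector \<Rightarrow>\<^sub>L 'b::real_normed_vector) \<Rightarrow> 'b dual \<Rightarrow> 'a dual" where
  "adjoint A w = w o\<^sub>L A"

definition msub :: "'c::ab_group_add set \<Rightarrow> 'c set \<Rightarrow> 'c set" where
  "msub C D = {c - d | c d. c \<in> C \<and> d \<in> D}"

definition E_set :: "('a::real_normed_vector \<Rightarrow>\<^sub>L 'b::real_normed_vector) \<Rightarrow> (('b \<times> 'b dual) \<times> 'a dual) set" where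
  "E_set A = {((blinfun_apply A x, w), adjoint A w) | x w. True}"

definition icr :: "'c::real_vector set \<Rightarrow> 'c set" where
  "icr D = {u. \<forall>x\<in>affine hull (msub D D). \<exists>\<delta>>0. \<forall>t\<in>{0..\<delta>}. u + t *\<^sub>R x \<in> D}"

definition ic :: "'c::real_normed_vector set \<Rightarrow> 'c set" where
  "ic D = (if closed (affine hull D) then icr D else {})"

definition ri :: "'c::real_normed_vector set \<Rightarrow> 'c set" where
  "ri D = (if closed (affine hull D) then rel_interior D else {})"

end

(*
  Write D1, D2, D3 for the three differences, so that D1 <= D2 <= D3.

  The core of D3 lies in D1. After a translation let ((b, a), c) be a core point of D3. Minimising
  hS + hT under the constraints (x1, c + A* w) in dom hS, (b + A x2, a + w) in dom hT with
  x = x1 + x2, x* = A* w prescribed gives a convex function on X x X* (it belongs to the parallel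
  sum of the shifted S and A* T A) that lies above the coupling. At a core point Lagrange multipliers
  exist, and with them the strong representation property shows that its conjugate lies above the
  coupling as well. By the argument of Marques Alves and Svaiter its closure meets the coupling. At
  such a point the multipliers are points of the Gossez closures of S and T; since D(closure of S)
  lies in X, they are points of S and T themselves, which exhibits ((b, a), c) as a point of D1.

  The core of D3 is its relative interior. D3 is an increasing union of images of bounded closed
  convex sets, so Baire's theorem and a halving series apply. This also yields the bound near the
  origin that the Lagrange multipliers need.

  Closed affine hulls agree. If a functional (p, q, r) is constant on D1, then q p = 0, and the lines
  through points of T in direction (q, p), and through points of S in direction (r, 0), stay in the
  Gossez closures; type (D) bounds hT and hS from below along them, which forces the functional to
  be constant on D3.
*)
theory Submission
  imports Defs
begin

section \<open>Sublinear functionals and Hahn-Banach\<close>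

definition sublinear :: "('v::real_vector \<Rightarrow> real) \<Rightarrow> bool" where
  "sublinear p \<longleftrightarrow> (\<forall>x y. p (x + y) \<le> p x + p y) \<and> (\<forall>t x. 0 \<le> t \<longrightarrow> p (t *\<^sub>R x) = t * p x)"

lemma sublinear_add: "sublinear p \<Longrightarrow> p (x + y) \<le> p x + p y"
  and sublinear_scale: "sublinear p \<Longrightarrow> 0 \<le> t \<Longrightarrow> p (t *\<^sub>R x) = t * p x"
  by (auto simp: sublinear_def)

lemma sublinear_zero: "sublinear p \<Longrightarrow> p 0 = 0"
  using sublinear_scale[of p 0 0] by simp

lemma sublinear_neg: "sublinear p \<Longrightarrow> - p (- x) \<le> p x"
  using sublinear_add[of p x "- x"] sublinear_zero[of p] by simp

text \<open>\<open>q\<close> is the infimal convolution of \<open>p\<close> with a convex cone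
  \<open>K\<close> of displacements \<open>c\<close> at cost \<open>r\<close>. Nonnegativity of
  \<open>p c + r\<close> on \<open>K\<close> bounds the infimum below by \<open>- p (- x)\<close>.
  Suitable choices of \<open>K\<close> yield both the linearity of minimal sublinear functionals and
  the Mazur-Orlicz theorem.\<close>

lemma sublinear_cone_inf:
  fixes p :: "'v::real_vector \<Rightarrow> real" and K :: "('v \<times> real) set"
  assumes p: "sublinear p" and K0: "0 \<in> K"
    and Kadd: "\<And>a b. a \<in> K \<Longrightarrow> b \<in> K \<Longrightarrow> a + b \<in> K"
    and Kscale: "\<And>t a. 0 < t \<Longrightarrow> a \<in> K \<Longrightarrow> t *\<^sub>R a \<in> K"
    and nn: "\<And>c r. (c, r) \<in> K \<Longrightarrow> 0 \<le> p c + r"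
  obtains q where "sublinear q" "\<And>x. q x \<le> p x" "\<And>x c r. (c, r) \<in> K \<Longrightarrow> q x \<le> p (x + c) + r"
proof -
  define q where "q x = (INF a\<in>K. p (x + fst a) + snd a)" for x
  have bd: "- p (- x) \<le> p (x + fst a) + snd a" if "a \<in> K" for x a
    using nn[of "fst a" "snd a"] that sublinear_add[OF p, of "- x" "x + fst a"] by simp
  have bdd: "bdd_below ((\<lambda>a. p (x + fst a) + snd a) ` K)" for x
    using bd[of _ x] by (intro bdd_belowI[of _ "- p (- x)"]) auto
  have low: "q x \<le> p (x + fst a) + snd a" if "a \<in> K" for x a
    unfolding q_def using that by (intro cINF_lower bdd)
  have gr: "m \<le> q x" if "\<And>a. a \<in> K \<Longrightarrow> m \<le> p (x + fst a) + snd a" for m x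
    unfolding q_def using K0 that by (intro cINF_greatest) auto
  have add: "q (x + y) \<le> q x + q y" for x y
  proof -
    have "q (x + y) - (p (x + fst a) + snd a) \<le> q y" if a: "a \<in> K" for a
    proof (rule gr)
      fix b assume b: "b \<in> K"
      have "q (x + y) \<le> p (x + y + fst (a + b)) + snd (a + b)"
        by (rule low) (rule Kadd[OF a b])
      also have "\<dots> \<le> p (x + fst a) + p (y + fst b) + snd a + snd b"
        using sublinear_add[OF p, of "x + fst a" "y + fst b"] by (simp add: algebra_simps)
      finally show "q (x + y) - (p (x + fst a) + snd a) \<le> p (y + fst b) + snd b" by simp
    qed
    then have "q (x + y) - q y \<le> q x"
      by (intro gr) (simp add: algebra_simps)
    then show ?thesis by simp
  qed
  have scale_le: "q (t *\<^sub>R x) \<le> t * q x" if t: "0 < t" for t x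
  proof -
    have "q (t *\<^sub>R x) / t \<le> q x"
    proof (rule gr)
      fix a assume a: "a \<in> K"
      have "q (t *\<^sub>R x) \<le> p (t *\<^sub>R x + fst (t *\<^sub>R a)) + snd (t *\<^sub>R a)"
        by (rule low) (rule Kscale[OF t a])
      also have "\<dots> = t * (p (x + fst a) + snd a)"
        using sublinear_scale[OF p, of t "x + fst a"] t by (simp add: algebra_simps)
      finally show "q (t *\<^sub>R x) / t \<le> p (x + fst a) + snd a" using t by (simp add: field_simps)
    qed
    then show ?thesis using t by (simp add: field_simps)
  qed
  have q0: "q 0 = 0"
  proof (rule antisym)
    show "q 0 \<le> 0" using low[OF K0, of 0] sublinear_zero[OF p] by simp
    show "0 \<le> q 0" by (rule gr) (use nn in auto)
  qed
  \<comment> \<open>The reverse inequality is \<open>scale_le\<close> for \<open>inverse t\<close>,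
    applied to the already scaled vector.\<close>
  have scale: "q (t *\<^sub>R x) = t * q x" if t: "0 \<le> t" for t x
  proof (cases "t = 0")
    case False
    then have "0 < t" using t by simp
    then have "q (inverse t *\<^sub>R (t *\<^sub>R x)) \<le> inverse t * q (t *\<^sub>R x)" by (intro scale_le) simp
    then have "t * q x \<le> q (t *\<^sub>R x)" using \<open>0 < t\<close> by (simp add: field_simps)
    with scale_le[OF \<open>0 < t\<close>, of x] show ?thesis by simp
  qed (simp add: q0)
  show ?thesis
  proof
    show "sublinear q" using add scale by (auto simp: sublinear_def)
    show "q x \<le> p x" for x using low[OF K0, of x] by simp
    show "q x \<le> p (x + c) + r" if "(c, r) \<in> K" for x c r using low[OF that, of x] by simp
  qed
qed

text \<open>Zorn's lemma for the reversed pointwise order: the pointwise infimum of a chain is again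
  sublinear, and it is finite because every member \<open>q\<close> satisfies
  \<open>- p (- x) <= - q (- x) <= q x\<close>.\<close>

lemma minimal_sublinear_exists:
  fixes p :: "'v::real_vector \<Rightarrow> real"
  assumes p: "sublinear p"
  obtains q where "sublinear q" "\<And>x. q x \<le> p x"
    "\<And>q'. sublinear q' \<Longrightarrow> (\<And>x. q' x \<le> q x) \<Longrightarrow> q' = q"
proof -
  define A where "A = {q. sublinear q \<and> q \<le> p}"
  have "\<exists>m\<in>A. \<forall>a\<in>A. m \<ge> a \<longrightarrow> a = m"
  proof (rule predicate_Zorn)
    show "partial_order_on A (relation_of (\<ge>) A)"
      by (rule partial_order_on_relation_ofI) auto
    fix C assume "C \<in> Chains (relation_of (\<ge>) A)"
    then have CA: "q \<in> A" and Ctot: "q \<le> q' \<or> q' \<le> q" if "q \<in> C" "q' \<in> C" for q q'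
      using that by (auto simp: Chains_def relation_of_def)
    show "\<exists>u\<in>A. \<forall>a\<in>C. a \<ge> u"
    proof (cases "C = {}")
      case True
      then show ?thesis using p by (auto simp: A_def)
    next
      case False
      then obtain q0 where q0: "q0 \<in> C" by blast
      have sub: "sublinear q" and le: "\<And>x. q x \<le> p x" if "q \<in> C" for q
        using CA[OF that that] by (auto simp: A_def le_fun_def)
      define u where "u x = (INF q\<in>C. q x)" for x
      have bdd: "bdd_below ((\<lambda>q. q x) ` C)" for x
      proof (rule bdd_belowI[of _ "- p (- x)"])
        fix r assume "r \<in> (\<lambda>q. q x) ` C"
        then obtain q where q: "q \<in> C" "r = q x" by auto
        then show "- p (- x) \<le> r"
          using sublinear_neg[OF sub, of q x] le[of q "- x"] by simp
      qed
      have low: "u x \<le> q x" if "q \<in> C" for q x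
        unfolding u_def using that by (intro cINF_lower bdd)
      have gr: "m \<le> u x" if "\<And>q. q \<in> C \<Longrightarrow> m \<le> q x" for m x
        unfolding u_def using False that by (intro cINF_greatest) auto
      have "u (x + y) \<le> u x + u y" for x y
      proof -
        have "u (x + y) - q x \<le> u y" if q: "q \<in> C" for q
        proof (rule gr)
          fix q' assume q': "q' \<in> C"
          \<comment> \<open>One member of the chain lies below both \<open>q\<close> and
            \<open>q'\<close>; its subadditivity controls two independent infima.\<close>
          obtain s where s: "s \<in> C" "s \<le> q" "s \<le> q'" using Ctot[OF q q'] q q' by auto
          have "u (x + y) \<le> s x + s y" using low[OF s(1), of "x + y"] sublinear_add[OF sub[OF s(1)], of x y] by linarith
          then show "u (x + y) - q x \<le> q' y" using le_funD[OF s(2), of x] le_funD[OF s(3), of y] by linarith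
        qed
        then have "u (x + y) - u y \<le> u x" by (intro gr) (simp add: algebra_simps)
        then show ?thesis by simp
      qed
      moreover have "u (t *\<^sub>R x) = t * u x" if t: "0 \<le> t" for t x
      proof (rule antisym)
        show "t * u x \<le> u (t *\<^sub>R x)"
          by (rule gr) (use low t sub in \<open>auto simp: sublinear_scale intro: mult_left_mono\<close>)
        show "u (t *\<^sub>R x) \<le> t * u x"
        proof (cases "t = 0")
          case True
          then show ?thesis using low[OF q0, of 0] sublinear_zero[OF sub[OF q0]] by simp
        next
          case False
          then have "u (t *\<^sub>R x) / t \<le> u x"
            using t low[of _ "t *\<^sub>R x"] by (intro gr) (simp add: field_simps sublinear_scale[OF sub])
          then show ?thesis using False t by (simp add: field_simps)
        qed
      qed
      ultimately have "sublinear u" by (auto simp: sublinear_def)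
      moreover have "u \<le> p" using low[OF q0] le[OF q0] by (auto simp: le_fun_def intro: order_trans)
      ultimately show ?thesis using low by (auto simp: A_def le_fun_def)
    qed
  qed
  then obtain m where "m \<in> A" and min: "\<And>a. a \<in> A \<Longrightarrow> a \<le> m \<Longrightarrow> a = m" by blast
  show ?thesis
  proof
    show "sublinear m" "\<And>x. m x \<le> p x" using \<open>m \<in> A\<close> by (auto simp: A_def le_fun_def)
    show "q' = m" if "sublinear q'" "\<And>x. q' x \<le> m x" for q'
      using that \<open>m \<in> A\<close> by (intro min) (auto simp: A_def le_fun_def intro: order_trans)
  qed
qed

text \<open>A minimal sublinear functional is linear: lowering it along a ray cannot change it,
  which gives superadditivity, and additivity with positive homogeneity gives all scalars.\<close>

lemma sublinear_dominates_linear: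
  fixes p :: "'v::real_vector \<Rightarrow> real"
  assumes p: "sublinear p"
  obtains L where "linear L" "\<And>x. L x \<le> p x"
proof -
  obtain q where q: "sublinear q" and qp: "\<And>x. q x \<le> p x"
    and min: "\<And>q'. sublinear q' \<Longrightarrow> (\<And>x. q' x \<le> q x) \<Longrightarrow> q' = q"
    using minimal_sublinear_exists[OF p] by blast
  have super: "q x + q y \<le> q (x + y)" for x y
  proof -
    \<comment> \<open>On this ray \<open>q c + r\<close> vanishes. The generator
      \<open>(y, - q y)\<close> later gives \<open>q x <= q (x + y) - q y\<close>.\<close>
    define K where "K = (\<lambda>t. (t *\<^sub>R y, - t * q y)) ` {0..}"
    obtain q' where "sublinear q'" "\<And>x. q' x \<le> q x"
      and q'K: "\<And>x c r. (c, r) \<in> K \<Longrightarrow> q' x \<le> q (x + c) + r"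
    proof (rule sublinear_cone_inf[OF q])
      show "0 \<in> K" unfolding K_def by (rule image_eqI[of _ _ 0]) (auto simp: zero_prod_def)
      show "a + b \<in> K" if "a \<in> K" "b \<in> K" for a b
      proof -
        obtain s t where "0 \<le> s" "0 \<le> t" "a = (s *\<^sub>R y, - s * q y)" "b = (t *\<^sub>R y, - t * q y)"
          using \<open>a \<in> K\<close> \<open>b \<in> K\<close> unfolding K_def by auto
        then show ?thesis unfolding K_def by (intro image_eqI[of _ _ "s + t"]) (auto simp: algebra_simps)
      qed
      show "t *\<^sub>R a \<in> K" if "0 < t" "a \<in> K" for t a
      proof -
        obtain s where "0 \<le> s" "a = (s *\<^sub>R y, - s * q y)"
          using \<open>a \<in> K\<close> unfolding K_def by auto
        then show ?thesis unfolding K_def using \<open>0 < t\<close> by (intro image_eqI[of _ _ "t * s"]) auto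
      qed
      show "0 \<le> q c + r" if "(c, r) \<in> K" for c r
        using that by (auto simp: K_def sublinear_scale[OF q])
    qed blast
    then have "q' = q" by (intro min)
    moreover have "(y, - q y) \<in> K" unfolding K_def by (intro image_eqI[of _ _ 1]) auto
    ultimately show ?thesis using q'K[of y "- q y" x] by simp
  qed
  have add: "q (x + y) = q x + q y" for x y
    using super[of x y] sublinear_add[OF q, of x y] by simp
  have neg: "q (- x) = - q x" for x
    using add[of x "- x"] sublinear_zero[OF q] by simp
  have "q (t *\<^sub>R x) = t * q x" for t x
  proof (cases "0 \<le> t")
    case False
    then have "q ((- t) *\<^sub>R (- x)) = (- t) * q (- x)" by (intro sublinear_scale[OF q]) simp
    then show ?thesis by (simp add: neg)
  qed (rule sublinear_scale[OF q])
  with add have "linear q" by (intro linearI) auto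
  with qp that show ?thesis by blast
qed

text \<open>Nonnegativity extends from \<open>C\<close> to the convex cone it generates, so
  \<open>p\<close> can first be lowered along that cone; every linear functional below the lowered
  one is nonnegative on \<open>C\<close>.\<close>

lemma Mazur_Orlicz:
  fixes p :: "'v::real_vector \<Rightarrow> real"
  assumes p: "sublinear p" and C: "convex C" and nn: "\<And>v r. (v, r) \<in> C \<Longrightarrow> 0 \<le> p v + r"
  obtains L where "linear L" "\<And>x. L x \<le> p x" "\<And>v r. (v, r) \<in> C \<Longrightarrow> 0 \<le> L v + r"
proof (cases "C = {}")
  case True
  then show ?thesis using sublinear_dominates_linear[OF p] that by blast
next
  case False
  \<comment> \<open>For nonempty \<open>C\<close> the insertion changes nothing and makes membership
    of 0 immediate. The empty set is split off since its cone hull is empty.\<close>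
  define K where "K = insert 0 (cone hull C)"
  have K: "K = cone hull C" unfolding K_def using False
    by (metis cone_0 cone_cone_hull cone_contains_0 cone_hull_empty_iff insert_absorb)
  obtain q where "sublinear q" and qp: "\<And>x. q x \<le> p x"
      and qK: "\<And>x c r. (c, r) \<in> K \<Longrightarrow> q x \<le> p (x + c) + r"
  proof (rule sublinear_cone_inf[OF p])
    show "0 \<in> K" by (simp add: K_def)
    have "convex K \<and> cone K" unfolding K using convex_cone_hull[OF C] cone_cone_hull[of C] ..
    then have "\<forall>a\<in>K. \<forall>b\<in>K. a + b \<in> K" unfolding convex_cone ..
    then show "a + b \<in> K" if "a \<in> K" "b \<in> K" for a b using that by blast
    show "t *\<^sub>R a \<in> K" if "0 < t" "a \<in> K" for t a
      using that K by (simp add: cone_cone_hull mem_cone)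
    show "0 \<le> p c + r" if crK: "(c, r) \<in> K" for c r
    proof -
      obtain t a where a: "0 \<le> t" "a \<in> C" "(c, r) = t *\<^sub>R a"
        using crK unfolding K cone_hull_expl mem_Collect_eq by metis
      obtain v s where vs: "a = (v, s)" by (rule prod.exhaust)
      have "(v, s) \<in> C" using a(2) unfolding vs .
      have "c = t *\<^sub>R v" "r = t * s" using a(3) unfolding vs by simp_all
      with a(1) have "p c + r = t * (p v + s)" by (simp add: sublinear_scale[OF p] distrib_left)
      then show ?thesis using nn[OF \<open>(v, s) \<in> C\<close>] a(1) by simp
    qed
  qed blast
  obtain L where L: "linear L" "\<And>x. L x \<le> q x" using sublinear_dominates_linear[OF \<open>sublinear q\<close>] by blast
  show ?thesis
  proof
    show "linear L" by fact
    show "L x \<le> p x" for x using L(2)[of x] qp[of x] by simp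
    show "0 \<le> L v + r" if "(v, r) \<in> C" for v r
    proof -
      \<comment> \<open>Evaluation at \<open>- v\<close> cancels the displacement:
        \<open>L (- v) <= q (- v) <= p 0 + r = r\<close>.\<close>
      have "(v, r) \<in> K" unfolding K using that by (simp add: hull_inc)
      then show ?thesis using qK[of v r "- v"] L(2)[of "- v"] sublinear_zero[OF p]
        linear_neg[OF L(1), of v] by simp
    qed
  qed
qed

text \<open>Domination by a multiple of the norm, used at \<open>x\<close> and at
  \<open>- x\<close>, makes the linear functional continuous.\<close>

lemma Mazur_Orlicz_norm:
  fixes C :: "('v::real_normed_vector \<times> real) set"
  assumes k: "0 \<le> k" and C: "convex C" and nn: "\<And>v r. (v, r) \<in> C \<Longrightarrow> 0 \<le> k * norm v + r"
  obtains L :: "'v \<Rightarrow>\<^sub>L real" where "\<And>v r. (v, r) \<in> C \<Longrightarrow> 0 \<le> L v + r"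
proof -
  have "sublinear (\<lambda>v::'v. k * norm v)"
    using k by (auto simp: sublinear_def simp flip: distrib_left intro!: mult_left_mono norm_triangle_ineq)
  from Mazur_Orlicz[OF this C] nn
  obtain L where L: "linear L" and le: "\<And>x::'v. L x \<le> k * norm x"
    and LC: "\<And>v r. (v, r) \<in> C \<Longrightarrow> 0 \<le> L v + r" by metis
  have "bounded_linear L"
  proof (rule bounded_linear_intro[of _ k])
    show "L (x + y) = L x + L y" "L (t *\<^sub>R x) = t *\<^sub>R L x" for x y t
      using L by (simp_all add: linear_add linear_scale)
    show "norm (L x) \<le> norm x * k" for x
      using le[of x] le[of "- x"] linear_neg[OF L, of x] by (simp add: abs_le_iff mult.commute)
  qed
  then show ?thesis using LC that[of "Blinfun L"] by (simp add: bounded_linear_Blinfun_apply)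
qed

text \<open>The translate of \<open>W\<close> by \<open>v\<close> is placed at height -1. A distance
  of at least \<open>e\<close> between \<open>v\<close> and \<open>W\<close> gives
  \<open>inverse e * norm (w + v) >= 1\<close>, hence a functional with
  \<open>1 <= L w + L v\<close> on all of \<open>W\<close>; on a subspace this forces
  \<open>L w = 0\<close>.\<close>

lemma subspace_separation:
  fixes W :: "'v::real_normed_vector set"
  assumes W: "subspace W" "closed W" and v: "v \<notin> W"
  obtains L :: "'v \<Rightarrow>\<^sub>L real" where "\<And>w. w \<in> W \<Longrightarrow> L w = 0" "L v \<noteq> 0"
proof -
  obtain e where e: "0 < e" and ball: "\<And>w. dist w v < e \<Longrightarrow> w \<notin> W"
    using W(2) v by (metis ComplD ComplI closed_def open_dist)
  define C where "C = (\<lambda>w. (w + v, - 1 :: real)) ` W"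
  have "convex C"
  proof -
    have "C = W \<times> {0} + {(v, - 1)}" unfolding C_def set_plus_def by (auto simp: image_iff)
    then show ?thesis using W(1)
      by (simp add: convex_Times convex_set_plus subspace_imp_convex)
  qed
  moreover have "0 \<le> inverse e * norm u + r" if "(u, r) \<in> C" for u r
  proof -
    obtain w where w: "w \<in> W" "u = w + v" "r = - 1" using \<open>(u, r) \<in> C\<close> by (auto simp: C_def)
    have "- w \<in> W" using w W by (simp add: subspace_neg)
    then have "e \<le> norm u" using ball[of "- w"] w by (auto simp: dist_norm norm_minus_commute algebra_simps)
        (metis add.commute minus_add_distrib norm_minus_cancel not_le)
    then show ?thesis using e w by (simp add: field_simps)
  qed
  moreover have "0 \<le> inverse e" using e by simp
  ultimately obtain L :: "'v \<Rightarrow>\<^sub>L real" where L: "\<And>u r. (u, r) \<in> C \<Longrightarrow> 0 \<le> L u + r"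
    using Mazur_Orlicz_norm[of "inverse e" C] by blast
  have ge: "1 \<le> L w + L v" if "w \<in> W" for w
    using L[of "w + v" "- 1"] that by (auto simp: C_def blinfun.add_right)
  have "L w = 0" if w: "w \<in> W" for w
  proof (rule ccontr)
    assume n: "L w \<noteq> 0"
    \<comment> \<open>The multiple is chosen so that \<open>L\<close> takes the value
      \<open>- L v\<close> there, turning \<open>ge\<close> into \<open>1 <= 0\<close>.\<close>
    have "(- (L v / L w)) *\<^sub>R w \<in> W" by (intro subspace_scale W w)
    from ge[OF this] show False using n by (simp add: blinfun.scaleR_right blinfun.minus_right)
  qed
  moreover have "L v \<noteq> 0" using ge[of 0] W by (simp add: subspace_0)
  ultimately show ?thesis using that by blast
qed

text \<open>\<open>C\<close> plays the role of the epigraph of a convex function on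
  \<open>W\<close>. An upper bound on a ball of \<open>W\<close> and the lower bound
  \<open>m\<close> at the origin bound its descent by the slope \<open>(M - m) / d\<close>, and the
  Hahn-Banach argument then gives a subgradient at 0 defined on the whole space.\<close>

lemma convex_subgradient:
  fixes C :: "('v::real_normed_vector \<times> real) set"
  assumes C: "convex C" and W: "subspace W" and CW: "\<And>v r. (v, r) \<in> C \<Longrightarrow> v \<in> W"
    and d: "0 < d" and bdd: "\<And>v. v \<in> W \<Longrightarrow> norm v \<le> d \<Longrightarrow> \<exists>r\<le>M. (v, r) \<in> C"
    and m: "\<And>r. (0, r) \<in> C \<Longrightarrow> m \<le> r"
  obtains L :: "'v \<Rightarrow>\<^sub>L real" where "\<And>v r. (v, r) \<in> C \<Longrightarrow> m \<le> L v + r"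
proof -
  define k where "k = (M - m) / d"
  obtain r0 where "r0 \<le> M" "(0, r0) \<in> C" using bdd[of 0] d subspace_0[OF W] by auto
  then have mM: "m \<le> M" using m[of r0] by simp
  then have k0: "0 \<le> k" using d by (simp add: k_def)
  define C' where "C' = (\<lambda>a. a - (0, m)) ` C"
  have "convex C'" unfolding C'_def using C by (simp add: convex_translation_subtract)
  moreover have "0 \<le> k * norm v + r" if vr: "(v, r) \<in> C'" for v r
  proof -
    have vC: "(v, r + m) \<in> C" using vr by (auto simp: C'_def)
    show ?thesis
    proof (cases "v = 0")
      case True
      then show ?thesis using m[of "r + m"] vC by simp
    next
      case False
      define n where "n = norm v"
      have n: "0 < n" using False by (simp add: n_def)
      \<comment> \<open>The point at distance \<open>d\<close> opposite to \<open>v\<close>: the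
        origin is a convex combination of \<open>v\<close> and \<open>w\<close>, the height over
        \<open>w\<close> is at most \<open>M\<close>, and the height over the origin is at least
        \<open>m\<close>.\<close>
      define w where "w = (- (d / n)) *\<^sub>R v"
      have "w \<in> W" unfolding w_def by (intro subspace_scale W CW[OF vC])
      moreover have "norm w \<le> d" using n d by (simp add: w_def n_def)
      ultimately obtain s where s: "s \<le> M" "(w, s) \<in> C" using bdd by blast
      have "(n / (n + d)) *\<^sub>R (w, s) + (d / (n + d)) *\<^sub>R (v, r + m) \<in> C"
      proof (rule convexD[OF C s(2) vC])
        show "0 \<le> n / (n + d)" "0 \<le> d / (n + d)" using n d by simp_all
        have "n + d \<noteq> 0" using n d by simp
        then show "n / (n + d) + d / (n + d) = 1"
          by (metis add_divide_distrib divide_self)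
      qed
      moreover have "(n / (n + d)) *\<^sub>R w + (d / (n + d)) *\<^sub>R v = 0"
        using n d by (simp add: w_def field_simps)
      ultimately have "m \<le> (n / (n + d)) * s + (d / (n + d)) * (r + m)"
        by (intro m) simp
      also have "\<dots> = (n * s + d * (r + m)) / (n + d)" using n d by (simp add: add_divide_distrib)
      finally have "m * (n + d) \<le> n * s + d * (r + m)" using n d by (simp add: field_simps)
      also have "\<dots> \<le> n * M + d * (r + m)" using s n by simp
      finally have "0 \<le> n * (M - m) + d * r" by (simp add: algebra_simps)
      then show ?thesis using d by (simp add: k_def n_def field_simps)
    qed
  qed
  ultimately obtain L :: "'v \<Rightarrow>\<^sub>L real" where L: "\<And>v r. (v, r) \<in> C' \<Longrightarrow> 0 \<le> L v + r"
    using Mazur_Orlicz_norm[OF k0] by blast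
  show ?thesis
  proof
    fix v r assume "(v, r) \<in> C"
    then have "(v, r - m) \<in> C'" unfolding C'_def by (intro image_eqI[of _ _ "(v, r)"]) auto
    from L[OF this] show "m \<le> L v + r" by simp
  qed
qed

section \<open>An open mapping theorem for convex sets\<close>

text \<open>Successive approximation for the affine map \<open>G z - g\<close>: approximate the
  target to within \<open>e / 2\<close>, double the error, and repeat. The approximating points get
  weights 1/2, 1/4, and so on, with sum 1, so convexity and completeness produce an exact preimage
  in the closed set \<open>C\<close>.\<close>

lemma ball_subset_image_of_closure:
  fixes C :: "'z::banach set" and G :: "'z \<Rightarrow> 'v::real_normed_vector"
  assumes C: "closed C" "convex C" "bounded C" and G: "bounded_linear G" and W: "subspace W"
    and CW: "\<And>z. z \<in> C \<Longrightarrow> G z - g \<in> W" and e: "0 < e"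
    and cl: "\<And>v. v \<in> W \<Longrightarrow> norm v < e \<Longrightarrow> v \<in> closure ((\<lambda>z. G z - g) ` C)"
    and v: "v \<in> W" "norm v < e / 2"
  shows "v \<in> (\<lambda>z. G z - g) ` C"
proof -
  interpret G: bounded_linear G by fact
  define F where "F z = G z - g" for z
  have "\<exists>c. c \<in> C \<and> norm (x - F c) < e / 2" if x: "x \<in> W" "norm x < e" for x
    using closure_approachableD[OF cl[OF x], of "e / 2"] e
    by (auto simp: F_def dist_norm norm_minus_commute)
  then obtain c where c: "\<And>x. x \<in> W \<Longrightarrow> norm x < e \<Longrightarrow> c x \<in> C \<and> norm (x - F (c x)) < e / 2"
    by metis
  \<comment> \<open>The sequence of rescaled errors. It starts at \<open>2 v\<close> since the first
    weight is 1/2, and it stays in \<open>W\<close> with norm below \<open>e\<close>.\<close>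
  define r where "r = rec_nat (2 *\<^sub>R v) (\<lambda>_ x. 2 *\<^sub>R (x - F (c x)))"
  have r0: "r 0 = 2 *\<^sub>R v" and rS: "r (Suc n) = 2 *\<^sub>R (r n - F (c (r n)))" for n
    by (simp_all add: r_def)
  have r: "r n \<in> W \<and> norm (r n) < e" for n
  proof (induction n)
    case 0
    then show ?case using v W by (simp add: r0 subspace_scale)
  next
    case (Suc n)
    then show ?case using c[of "r n"] CW[of "c (r n)"] W
      by (auto simp: rS F_def intro!: subspace_scale subspace_diff)
  qed
  define z where "z n = c (r n)" for n
  have zC: "z n \<in> C" for n using c r by (simp add: z_def)
  \<comment> \<open>The weights in \<open>s n\<close> add up to \<open>1 - (1/2) ^ n\<close>; the
    missing weight \<open>(1/2) ^ n\<close> is given to a free point \<open>x\<close> below, which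
    keeps every intermediate sum a convex combination.\<close>
  define s where "s n = (\<Sum>k<n. (1/2) ^ Suc k *\<^sub>R z k)" for n
  have s_Suc: "s (Suc n) + (1/2) ^ Suc n *\<^sub>R x = s n + (1/2) ^ n *\<^sub>R ((1/2) *\<^sub>R z n + (1/2) *\<^sub>R x)" for n x
    by (simp add: s_def algebra_simps)
  have sC: "s n + (1/2) ^ n *\<^sub>R x \<in> C" if "x \<in> C" for n x
    using that
  proof (induction n arbitrary: x)
    case (Suc n)
    have "(1/2) *\<^sub>R z n + (1/2) *\<^sub>R x \<in> C" using zC Suc.prems by (intro convexD[OF C(2)]) auto
    then show ?case unfolding s_Suc by (rule Suc.IH)
  qed (simp add: s_def)
  have Fs: "F (s n + (1/2) ^ n *\<^sub>R x) = v + (1/2) ^ n *\<^sub>R (F x - (1/2) *\<^sub>R r n)" for n x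
  proof (induction n arbitrary: x)
    case 0
    show ?case by (simp add: s_def r0)
  next
    case (Suc n)
    have g2: "g = (1/2) *\<^sub>R g + (1/2) *\<^sub>R g" by (simp flip: scaleR_left_distrib)
    have mid: "F ((1/2) *\<^sub>R z n + (1/2) *\<^sub>R x) = (1/2) *\<^sub>R F (z n) + (1/2) *\<^sub>R F x"
      unfolding F_def G.add G.scaleR by (subst (1) g2) (simp add: algebra_simps)
    show ?case unfolding s_Suc Suc.IH mid rS by (simp add: z_def algebra_simps)
  qed
  obtain B where B: "\<And>x. x \<in> C \<Longrightarrow> norm x \<le> B" using C(3) by (auto simp: bounded_iff)
  have "summable (\<lambda>k. (1/2) ^ Suc k *\<^sub>R z k)"
  proof (rule summable_comparison_test)
    show "\<exists>N. \<forall>n\<ge>N. norm ((1/2) ^ Suc n *\<^sub>R z n) \<le> B * (1/2) ^ n"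
    proof (intro exI allI impI)
      fix n
      have "0 \<le> B" using B[OF zC[of 0]] norm_ge_zero[of "z 0"] by linarith
      have "norm ((1/2) ^ Suc n *\<^sub>R z n) = (1/2) ^ Suc n * norm (z n)" by simp
      also have "\<dots> \<le> (1/2) ^ n * B"
        using B[OF zC[of n]] \<open>0 \<le> B\<close> by (intro mult_mono) auto
      finally show "norm ((1/2) ^ Suc n *\<^sub>R z n) \<le> B * (1/2) ^ n" by (simp add: mult.commute)
    qed
    show "summable (\<lambda>n. B * (1/2) ^ n :: real)" by (intro summable_mult summable_geometric) simp
  qed
  then have lim_s: "s \<longlonglongrightarrow> (\<Sum>k. (1/2) ^ Suc k *\<^sub>R z k)" (is "_ \<longlonglongrightarrow> ?s")
    unfolding s_def by (rule summable_LIMSEQ)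
  have pow0: "(\<lambda>n. (1/2) ^ n :: real) \<longlonglongrightarrow> 0" by (intro LIMSEQ_power_zero) simp
  \<comment> \<open>The fixed point \<open>z 0\<close> of \<open>C\<close> completes the weights to
    1 without changing the limit.\<close>
  have lim: "(\<lambda>n. s n + (1/2) ^ n *\<^sub>R z 0) \<longlonglongrightarrow> ?s"
    using tendsto_add[OF lim_s tendsto_scaleR[OF pow0 tendsto_const[of "z 0"]]] by simp
  have "?s \<in> C"
    using closed_sequentially[OF C(1) _ lim] sC zC by auto
  moreover have "F ?s = v"
  proof (rule LIMSEQ_unique)
    show "(\<lambda>n. F (s n + (1/2) ^ n *\<^sub>R z 0)) \<longlonglongrightarrow> F ?s"
      unfolding F_def by (intro tendsto_diff G.tendsto lim tendsto_const)
    have "Bfun (\<lambda>n. F (z 0) - (1/2) *\<^sub>R r n) sequentially"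
    proof (rule BfunI)
      show "\<forall>\<^sub>F n in sequentially. norm (F (z 0) - (1/2) *\<^sub>R r n) \<le> norm (F (z 0)) + e"
      proof (rule always_eventually, rule allI)
        fix n
        have "norm (F (z 0) - (1/2) *\<^sub>R r n) \<le> norm (F (z 0)) + norm ((1/2) *\<^sub>R r n)"
          by (rule norm_triangle_ineq4)
        also have "\<dots> \<le> norm (F (z 0)) + e" using r[of n] norm_ge_zero[of "r n"] unfolding norm_scaleR by linarith
        finally show "norm (F (z 0) - (1/2) *\<^sub>R r n) \<le> norm (F (z 0)) + e" .
      qed
    qed
    then have "(\<lambda>n. (1/2) ^ n *\<^sub>R (F (z 0) - (1/2) *\<^sub>R r n)) \<longlonglongrightarrow> 0"
      using bounded_bilinear.Zfun_prod_Bfun[OF bounded_bilinear_scaleR] pow0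
      by (simp add: tendsto_Zfun_iff)
    then show "(\<lambda>n. F (s n + (1/2) ^ n *\<^sub>R z 0)) \<longlonglongrightarrow> v"
      unfolding Fs using tendsto_add[OF tendsto_const[of v]] by fastforce
  qed
  ultimately show ?thesis unfolding F_def by blast
qed

text \<open>The core condition makes the sets \<open>n * closure (F n)\<close>, intersected with
  \<open>W\<close>, cover \<open>W\<close>, so by Baire one of them has interior. Averaging with a
  multiple of the opposite point moves the interior to the origin, and the previous lemma removes
  the closure.\<close>

lemma convex_exhaustion_open_mapping:
  fixes C :: "nat \<Rightarrow> 'z::banach set" and G :: "'z \<Rightarrow> 'v::banach"
  assumes C: "\<And>n. closed (C n)" "\<And>n. convex (C n)" "\<And>n. bounded (C n)"
    and mono: "\<And>m n. m \<le> n \<Longrightarrow> C m \<subseteq> C n"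
    and G: "bounded_linear G" and W: "subspace W" "closed W"
    and CW: "\<And>n z. z \<in> C n \<Longrightarrow> G z - g \<in> W"
    and core: "\<And>v. v \<in> W \<Longrightarrow> \<exists>\<delta>>0. \<forall>t\<in>{0..\<delta>}. \<exists>n. t *\<^sub>R v \<in> (\<lambda>z. G z - g) ` C n"
  shows "\<exists>n e. 0 < e \<and> (\<forall>v\<in>W. norm v < e \<longrightarrow> v \<in> (\<lambda>z. G z - g) ` C n)"
proof -
  interpret G: bounded_linear G by fact
  define F where "F n = (\<lambda>z. G z - g) ` C n" for n
  have conv: "convex (F n)" for n
  proof -
    have "F n = (\<lambda>x. x - g) ` (G ` C n)" by (auto simp: F_def)
    then show ?thesis using C(2) G.linear_axioms
      by (simp add: convex_translation_subtract convex_linear_image)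
  qed
  have Fmono: "m \<le> n \<Longrightarrow> F m \<subseteq> F n" for m n unfolding F_def using mono by (intro image_mono) auto
  have FW: "F n \<subseteq> W" for n using CW by (auto simp: F_def)
  obtain N0 where N0: "0 \<in> F N0"
  proof -
    obtain \<delta> where "\<delta> > 0" "\<forall>t\<in>{0..\<delta>}. \<exists>n. t *\<^sub>R 0 \<in> F n"
      using core[OF subspace_0[OF W(1)]] unfolding F_def by blast
    then show ?thesis using that by (metis atLeastAtMost_iff less_eq_real_def order_refl scaleR_zero_right)
  qed
  define T where "T n = {v \<in> W. inverse (real n) *\<^sub>R v \<in> closure (F n)}" for n
  have shrink: "inverse (real n) *\<^sub>R v \<in> D"
    if "convex D" "0 \<in> D" "m \<le> n" "0 < m" "inverse (real m) *\<^sub>R v \<in> D" for m n v D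
  proof -
    have "(real m / real n) *\<^sub>R (inverse (real m) *\<^sub>R v) + (1 - real m / real n) *\<^sub>R 0 \<in> D"
      using that by (intro convexD) auto
    then show ?thesis using that by (simp add: field_simps)
  qed
  \<comment> \<open>Scaling a point towards 0 stays in the set only if 0 belongs to it, which holds
    from \<open>N0\<close> on.\<close>
  have Tmono: "T m \<subseteq> T n" if "N0 \<le> m" "0 < m" "m \<le> n" for m n
  proof -
    have "0 \<in> closure (F n)" using N0 Fmono[of N0 n] that closure_subset[of "F n"] by auto
    moreover have "closure (F m) \<subseteq> closure (F n)" by (intro closure_mono Fmono that)
    ultimately show ?thesis using that shrink[OF convex_closure[OF conv], of n m]
      by (auto simp: T_def)
  qed
  have cover: "\<exists>n. N0 \<le> n \<and> 0 < n \<and> v \<in> T n" if v: "v \<in> W" for v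
  proof -
    obtain \<delta> where \<delta>: "\<delta> > 0" "\<And>t. t \<in> {0..\<delta>} \<Longrightarrow> \<exists>n. t *\<^sub>R v \<in> F n"
      using core[OF v] unfolding F_def by blast
    obtain k where k: "0 < k" "inverse (real k) < \<delta>"
      using \<delta>(1) by (metis ex_inverse_of_nat_less)
    then obtain m where m: "inverse (real k) *\<^sub>R v \<in> F m" using \<delta>(2)[of "inverse (real k)"] by auto
    define n where "n = max (max k m) N0"
    have "inverse (real n) *\<^sub>R v \<in> F n"
    proof (rule shrink[OF conv])
      show "0 \<in> F n" using N0 Fmono[of N0 n] by (auto simp: n_def)
      show "inverse (real k) *\<^sub>R v \<in> F n" using m Fmono[of m n] unfolding n_def by (auto simp: subset_iff le_max_iff_disj)
    qed (use k in \<open>auto simp: n_def\<close>)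
    then show ?thesis using v k closure_subset[of "F n"]
      by (intro exI[of _ n]) (auto simp: T_def n_def)
  qed
  define \<T> where "\<T> = T ` {n. N0 \<le> n \<and> 0 < n}"
  have TW: "T n \<subseteq> W" for n by (auto simp: T_def)
  have T_closed: "closed (T n)" for n
  proof -
    have "T n = W \<inter> (\<lambda>v. inverse (real n) *\<^sub>R v) -` closure (F n)" by (auto simp: T_def)
    then show ?thesis using W(2) by (auto intro!: closed_Int continuous_closed_vimage continuous_intros)
  qed
  have "\<exists>n. N0 \<le> n \<and> 0 < n \<and> top_of_set W interior_of T n \<noteq> {}"
  proof (rule ccontr)
    assume "\<not> ?thesis"
    then have "top_of_set W interior_of \<Union>\<T> = {}"
      using W(2) T_closed TW
      by (intro Baire_category_alt)
        (auto simp: \<T>_def closed_subset completely_metrizable_space_closedin completely_metrizable_space_euclidean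
          simp flip: closed_closedin)
    moreover have "\<Union>\<T> = W" using cover TW by (auto simp: \<T>_def)
    ultimately show False using subspace_0[OF W(1)] interior_of_topspace[of "top_of_set W"] by auto
  qed
  then obtain n v0 where n: "N0 \<le> n" "0 < n" and v0: "v0 \<in> top_of_set W interior_of T n" by blast
  then obtain U where "openin (top_of_set W) U" "v0 \<in> U" "U \<subseteq> T n" by (auto simp: interior_of_def)
  then obtain e where e: "0 < e" and eT: "\<And>x. x \<in> W \<Longrightarrow> dist x v0 < e \<Longrightarrow> x \<in> T n"
    by (auto simp: openin_euclidean_subtopology_iff subset_iff)
  have v0W: "v0 \<in> W" using \<open>v0 \<in> U\<close> \<open>U \<subseteq> T n\<close> TW by auto
  then have "- v0 \<in> W" using W(1) by (simp add: subspace_neg)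
  then obtain m where m: "N0 \<le> m" "0 < m" "- v0 \<in> T m" using cover by blast
  define P where "P = max m n"
  have P: "0 < P" using n by (simp add: P_def)
  have TP: "T m \<subseteq> T P" "T n \<subseteq> T P" using Tmono n m by (auto simp: P_def)
  \<comment> \<open>\<open>v\<close> is the midpoint of \<open>v0 + 2 P v\<close> and
    \<open>- v0\<close>, both scaled by \<open>1 / P\<close>.\<close>
  have "v \<in> closure (F P)" if v: "v \<in> W" "norm v < e / (2 * real P)" for v
  proof -
    have "v0 + (2 * real P) *\<^sub>R v \<in> T n"
    proof (rule eT)
      show "v0 + (2 * real P) *\<^sub>R v \<in> W" using v v0W W(1) by (simp add: subspace_add subspace_scale)
      show "dist (v0 + (2 * real P) *\<^sub>R v) v0 < e" using v P by (simp add: dist_norm field_simps)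
    qed
    then have a: "inverse (real P) *\<^sub>R (v0 + (2 * real P) *\<^sub>R v) \<in> closure (F P)"
      and b: "inverse (real P) *\<^sub>R (- v0) \<in> closure (F P)"
      using TP m by (auto simp: T_def)
    have "(1/2) *\<^sub>R (inverse (real P) *\<^sub>R (v0 + (2 * real P) *\<^sub>R v)) + (1/2) *\<^sub>R (inverse (real P) *\<^sub>R (- v0)) \<in> closure (F P)"
      using convexD[OF convex_closure[OF conv] a b, of "1/2" "1/2"] by simp
    then show ?thesis using P by (simp add: algebra_simps)
  qed
  then have "v \<in> F P" if "v \<in> W" "norm v < e / (2 * real P) / 2" for v
    unfolding F_def using that P e CW
    by (intro ball_subset_image_of_closure[OF C(1) C(2) C(3) G W(1), where e = "e / (2 * real P)"])
      (auto simp: F_def)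
  moreover have "0 < e / (2 * real P) / 2" using e P by simp
  ultimately show ?thesis unfolding F_def by metis
qed

section \<open>Convex functions above the coupling\<close>

lemma canon_apply [simp]: "blinfun_apply (canon x) f = blinfun_apply f x"
  unfolding canon_def by (simp add: bounded_linear_Blinfun_apply blinfun.bounded_linear_left)

lemma coupling_Pair [simp]: "coupling (x, u) = blinfun_apply u x"
  by (simp add: coupling_def)

lemma blinfun_prod_split:
  fixes L :: "('a::real_normed_vector \<times> 'b::real_normed_vector) \<Rightarrow>\<^sub>L real"
  obtains f g where "\<And>x y. blinfun_apply L (x, y) = blinfun_apply f x + blinfun_apply g y"
proof
  fix x y
  have "bounded_linear (\<lambda>x. L (x, 0))" "bounded_linear (\<lambda>y. L (0, y))"
    by (intro bounded_linear_compose[OF blinfun.bounded_linear_right] bounded_linear_Pair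
        bounded_linear_ident bounded_linear_zero)+
  then show "L (x, y) = Blinfun (\<lambda>x. L (x, 0)) x + Blinfun (\<lambda>y. L (0, y)) y"
    by (simp add: bounded_linear_Blinfun_apply flip: blinfun.add_right)
qed

lemma nonneg_of_nonneg_add_scaled:
  fixes a b :: real
  assumes "\<And>t. 0 < t \<Longrightarrow> t < 1 \<Longrightarrow> 0 \<le> a + t * b"
  shows "0 \<le> a"
proof (rule ccontr)
  assume "\<not> 0 \<le> a"
  then have a: "a < 0" by simp
  define t where "t = (- a) / (\<bar>b\<bar> - 2 * a)"
  have pos: "0 < \<bar>b\<bar> - 2 * a" using a by simp
  have t: "0 < t" unfolding t_def using a pos by (intro divide_pos_pos) auto
  have t1: "t < 1" unfolding t_def using a pos by (subst divide_less_eq_1_pos) auto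
  have eq: "t * (\<bar>b\<bar> - 2 * a) = - a" using pos by (simp add: t_def)
  have "t * b \<le> t * \<bar>b\<bar>" using t by simp
  moreover have "t * a < 0" using t a by (simp add: mult_pos_neg)
  ultimately have "a + t * b < 0" using eq by (simp add: algebra_simps)
  with assms[OF t t1] show False by simp
qed

text \<open>On the segment from the contact point to \<open>((y, v), s)\<close> the coupling is
  quadratic in the parameter \<open>t\<close>. After division by \<open>t\<close>, letting
  \<open>t\<close> tend to 0 leaves the linearised inequality.\<close>

lemma coupling_subgradient:
  fixes K :: "(('a::real_normed_vector \<times> 'a dual) \<times> real) set"
  assumes K: "convex K" and ge: "\<And>x u r. ((x, u), r) \<in> K \<Longrightarrow> blinfun_apply u x \<le> r"
    and xu: "((x, u), blinfun_apply u x) \<in> K" and yv: "((y, v), s) \<in> K"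
  shows "blinfun_apply u y + blinfun_apply v x - blinfun_apply u x \<le> s"
proof -
  have "0 \<le> (s - (u y + v x - u x)) + t * (- (v - u) (y - x))" if t: "0 < t" "t < 1" for t
  proof -
    have "(1 - t) *\<^sub>R ((x, u), u x) + t *\<^sub>R ((y, v), s) \<in> K"
      using t by (intro convexD[OF K xu yv]) auto
    then have "((1 - t) *\<^sub>R u + t *\<^sub>R v) ((1 - t) *\<^sub>R x + t *\<^sub>R y) \<le> (1 - t) * u x + t * s"
      by (intro ge) simp
    then have "0 \<le> t * ((s - (u y + v x - u x)) + t * (- (v - u) (y - x)))"
      by (simp add: blinfun.bilinear_simps algebra_simps)
    then show ?thesis using t(1) by (simp add: zero_le_mult_iff)
  qed
  then have "0 \<le> s - (u y + v x - u x)" by (rule nonneg_of_nonneg_add_scaled)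
  then show ?thesis by simp
qed

text \<open>The infimum over \<open>d\<close> of \<open>f d + (norm d)^2 / 2\<close> is
  \<open>- (norm f)^2 / 2\<close>, possibly not attained. A nearly optimal \<open>d\<close> is an
  almost norming vector rescaled to length \<open>norm f\<close> with the sign that makes
  \<open>f d\<close> negative.\<close>

lemma blinfun_almost_norming:
  fixes f :: "'a::real_normed_vector \<Rightarrow>\<^sub>L real"
  assumes e: "0 < e"
  obtains d where "blinfun_apply f d + (norm d)\<^sup>2 / 2 < e - (norm f)\<^sup>2 / 2"
proof (cases "norm f = 0")
  case True
  then show ?thesis using e that[of 0] by simp
next
  case False
  define N where "N = norm f"
  have N: "0 < N" using False by (simp add: N_def)
  \<comment> \<open>The first bound gives \<open>\<eta> * N < e\<close>, the permitted loss; the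
    second keeps \<open>N - \<eta>\<close> positive.\<close>
  define \<eta> where "\<eta> = min (e / (2 * N)) (N / 2)"
  have \<eta>: "0 < \<eta>" "\<eta> < N" using e N by (auto simp: \<eta>_def min_def)
  have "\<eta> * N \<le> e / (2 * N) * N" using N by (intro mult_right_mono) (auto simp: \<eta>_def)
  then have \<eta>N: "\<eta> * N < e" using N e by simp
  have "\<exists>x. \<not> norm (f x) \<le> (N - \<eta>) * norm x"
  proof (rule ccontr)
    assume "\<not> ?thesis"
    then have "norm f \<le> N - \<eta>" using \<eta> by (intro norm_blinfun_bound) auto
    then show False using \<eta> by (simp add: N_def)
  qed
  then obtain x where x: "(N - \<eta>) * norm x < \<bar>f x\<bar>" by (auto simp: not_le)
  have x0: "x \<noteq> 0" using x by auto
  define d where "d = (- (sgn (f x) * (N / norm x))) *\<^sub>R x"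
  have "f x \<noteq> 0" using le_less_trans[OF mult_nonneg_nonneg x] \<eta> by auto
  then have nd: "norm d = N" using N x0 by (simp add: d_def abs_mult abs_sgn_eq)
  have "f d = - (\<bar>f x\<bar> * (N / norm x))"
    by (simp add: d_def blinfun.bilinear_simps abs_sgn mult.commute mult.left_commute)
  also have "\<dots> < - (((N - \<eta>) * norm x) * (N / norm x))"
    using x N x0 by (intro neg_less_iff_less[THEN iffD2] mult_strict_right_mono) auto
  also have "\<dots> = \<eta> * N - N\<^sup>2" using x0 by (simp add: algebra_simps power2_eq_square)
  finally have "f d + (norm d)\<^sup>2 / 2 < e - (norm f)\<^sup>2 / 2"
    using \<eta>N nd by (simp add: N_def)
  then show ?thesis by (rule that)
qed

text \<open>Fenchel duality for the self-dual perturbation by half the squared norms; the conjugate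
  of the perturbation is only evaluated approximately, at one almost norming vector.\<close>

lemma exists_small_with_squares:
  fixes H :: "(('a::real_normed_vector \<times> 'a dual) \<times> real) set"
  assumes H: "convex H"
    and conj: "\<And>u p M. (\<And>x v r. ((x, v), r) \<in> H \<Longrightarrow> blinfun_apply u x + blinfun_apply p v - r \<le> M)
      \<Longrightarrow> blinfun_apply p u \<le> M"
    and e: "0 < e"
  shows "\<exists>x u r. ((x, u), r) \<in> H \<and> r + (norm x)\<^sup>2 / 2 + (norm u)\<^sup>2 / 2 < e"
proof (rule ccontr)
  assume "\<not> ?thesis"
  then have ge: "e \<le> r + (norm x)\<^sup>2 / 2 + (norm u)\<^sup>2 / 2" if "((x, u), r) \<in> H" for x u r
    using that by force
  define q :: "'a \<times> 'a dual \<Rightarrow> real" where "q d = (norm d)\<^sup>2 / 2" for d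
  have q_Pair: "q (x, u) = (norm x)\<^sup>2 / 2 + (norm u)\<^sup>2 / 2" for x u
    by (simp add: q_def norm_Pair)
  have q_convex: "q (a *\<^sub>R d + b *\<^sub>R d') \<le> a * q d + b * q d'" if ab: "0 \<le> a" "0 \<le> b" "a + b = 1" for a b d d'
  proof -
    have b: "b = 1 - a" using ab by simp
    have "norm (a *\<^sub>R d + b *\<^sub>R d') \<le> a * norm d + b * norm d'"
      using norm_triangle_ineq[of "a *\<^sub>R d" "b *\<^sub>R d'"] ab by simp
    then have "(norm (a *\<^sub>R d + b *\<^sub>R d'))\<^sup>2 \<le> (a * norm d + b * norm d')\<^sup>2"
      by (intro power_mono) auto
    also have "\<dots> = a * (norm d)\<^sup>2 + b * (norm d')\<^sup>2 - a * b * (norm d - norm d')\<^sup>2"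
      unfolding b by (simp add: power2_eq_square algebra_simps)
    also have "\<dots> \<le> a * (norm d)\<^sup>2 + b * (norm d')\<^sup>2" using ab by simp
    finally show ?thesis by (simp add: q_def)
  qed
  \<comment> \<open>Epigraph of the perturbed problem in which the two summands are evaluated at
    points differing by \<open>v\<close>; at \<open>v = 0\<close> its heights are at least
    \<open>e\<close> by \<open>ge\<close>.\<close>
  define C where "C = {(v, s). \<exists>z r d. (z, r) \<in> H \<and> v = z - d \<and> r + q d \<le> s}"
  have "convex C"
  proof (rule convexI)
    fix p p' a b
    assume p: "p \<in> C" "p' \<in> C" and ab: "(0::real) \<le> a" "0 \<le> b" "a + b = 1"
    obtain z r d s z' r' d' s' where zr: "(z, r) \<in> H" "p = (z - d, s)" "r + q d \<le> s"
      and zr': "(z', r') \<in> H" "p' = (z' - d', s')" "r' + q d' \<le> s'"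
      using p unfolding C_def by blast
    have "a *\<^sub>R (z, r) + b *\<^sub>R (z', r') \<in> H" by (rule convexD[OF H zr(1) zr'(1) ab])
    then have 1: "(a *\<^sub>R z + b *\<^sub>R z', a * r + b * r') \<in> H" by simp
    have "a * r + b * r' + q (a *\<^sub>R d + b *\<^sub>R d') \<le> a * (r + q d) + b * (r' + q d')"
      using q_convex[OF ab, of d d'] by (simp add: algebra_simps)
    also have "\<dots> \<le> a * s + b * s'"
      using zr(3) zr'(3) ab by (intro add_mono mult_left_mono)
    finally have "a * r + b * r' + q (a *\<^sub>R d + b *\<^sub>R d') \<le> a * s + b * s'" .
    moreover have "a *\<^sub>R (z - d) + b *\<^sub>R (z' - d') = (a *\<^sub>R z + b *\<^sub>R z') - (a *\<^sub>R d + b *\<^sub>R d')"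
      by (simp add: algebra_simps)
    ultimately have "(a *\<^sub>R (z - d) + b *\<^sub>R (z' - d'), a * s + b * s') \<in> C"
      unfolding C_def using 1 by blast
    then show "a *\<^sub>R p + b *\<^sub>R p' \<in> C" unfolding zr(2) zr'(2) by simp
  qed
  \<comment> \<open>For empty \<open>H\<close> the premise of \<open>conj\<close> would hold
    vacuously with bound -1 and give \<open>0 <= - 1\<close>.\<close>
  have "H \<noteq> {}"
    using conj[where u = 0 and p = 0 and M = "- 1"] by auto
  then obtain z0 r0 where z0: "(z0, r0) \<in> H" by auto
  obtain L :: "('a \<times> 'a dual) \<Rightarrow>\<^sub>L real" where L: "\<And>v s. (v, s) \<in> C \<Longrightarrow> e \<le> L v + s"
  proof (rule convex_subgradient[OF \<open>convex C\<close> subspace_UNIV, where d = 1 and m = e and M = "r0 + (norm z0 + 1)\<^sup>2 / 2"])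
    fix v :: "'a \<times> 'a dual" assume "norm v \<le> 1"
    then have "norm (z0 - v) \<le> norm z0 + 1" using norm_triangle_ineq4[of z0 v] by simp
    then have "(norm (z0 - v))\<^sup>2 \<le> (norm z0 + 1)\<^sup>2" by (intro power_mono) auto
    then have "r0 + q (z0 - v) \<le> r0 + (norm z0 + 1)\<^sup>2 / 2" by (simp add: q_def)
    moreover have "v = z0 - (z0 - v)" by simp
    then have "(v, r0 + q (z0 - v)) \<in> C" unfolding C_def using z0 by blast
    ultimately show "\<exists>r\<le>r0 + (norm z0 + 1)\<^sup>2 / 2. (v, r) \<in> C" by blast
  next
    fix s assume "(0, s) \<in> C"
    then obtain z r d where "(z, r) \<in> H" "0 = z - d" "r + q d \<le> s" unfolding C_def by blast
    then have "(z, r) \<in> H" "r + q z \<le> s" by simp_all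
    then show "e \<le> s" using ge[of "fst z" "snd z" r] q_Pair[of "fst z" "snd z"] by simp
  qed (auto)
  obtain f g where fg: "\<And>x y. L (x, y) = blinfun_apply f x + blinfun_apply g y"
    using blinfun_prod_split[of L] by blast
  obtain d where d: "blinfun_apply f d + (norm d)\<^sup>2 / 2 < e - (norm f)\<^sup>2 / 2"
    using blinfun_almost_norming[OF e] by blast
  \<comment> \<open>The test point \<open>D\<close> has second component \<open>- f\<close>, so that
    \<open>g f\<close> appears on both sides and cancels. What remains is
    \<open>e <= f d + (norm d)^2 / 2 + (norm f)^2 / 2\<close>, against the choice of
    \<open>d\<close>.\<close>
  have "(- g) (- f) \<le> f d - g f + (norm d)\<^sup>2 / 2 + (norm f)\<^sup>2 / 2 - e + 2 * g f"
  proof (rule conj)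
    fix x v r assume xvr: "((x, v), r) \<in> H"
    define D where "D = (- d, - f)"
    have "((x, v) - D, r + q D) \<in> C" unfolding C_def using xvr by blast
    then have "e \<le> L ((x, v) - D) + (r + q D)" by (rule L)
    then show "(- f) x + (- g) v - r \<le> f d - g f + (norm d)\<^sup>2 / 2 + (norm f)\<^sup>2 / 2 - e + 2 * g f"
      by (simp add: D_def fg q_Pair blinfun.bilinear_simps)
  qed
  then show False using d by (simp add: blinfun.bilinear_simps)
qed

text \<open>The previous lemma recentred at \<open>(x0, u0)\<close>. Translation must preserve the
  excess of the height over the coupling.\<close>

lemma exists_near_coupling:
  fixes H :: "(('a::real_normed_vector \<times> 'a dual) \<times> real) set"
  assumes H: "convex H"
    and conj: "\<And>u p M. (\<And>x v r. ((x, v), r) \<in> H \<Longrightarrow> blinfun_apply u x + blinfun_apply p v - r \<le> M)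
      \<Longrightarrow> blinfun_apply p u \<le> M"
    and e: "0 < e"
  shows "\<exists>x u r. ((x, u), r) \<in> H \<and>
    r - blinfun_apply u x + blinfun_apply (u - u0) (x - x0) + (norm (x - x0))\<^sup>2 / 2 + (norm (u - u0))\<^sup>2 / 2 < e"
proof -
  \<comment> \<open>The two quadratic terms cancel, so this map is affine and sends convex sets to
    convex sets.\<close>
  define \<phi> where "\<phi> = (\<lambda>((x, u), r). ((x - x0, u - u0), r - blinfun_apply u x + blinfun_apply (u - u0) (x - x0)))"
  have \<phi>: "\<phi> ((x, u), r) = ((x - x0, u - u0), r - u0 x - u x0 + u0 x0)" for x u r
    by (simp add: \<phi>_def blinfun.bilinear_simps)
  have "convex (\<phi> ` H)"
  proof (rule convexI)
    fix p p' a b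
    assume p: "p \<in> \<phi> ` H" "p' \<in> \<phi> ` H" and ab: "(0::real) \<le> a" "0 \<le> b" "a + b = 1"
    have b: "b = 1 - a" using ab by simp
    obtain x u r x' u' r' where *: "((x, u), r) \<in> H" "p = \<phi> ((x, u), r)"
      "((x', u'), r') \<in> H" "p' = \<phi> ((x', u'), r')"
      using p by auto
    have "a *\<^sub>R ((x, u), r) + b *\<^sub>R ((x', u'), r') \<in> H" by (rule convexD[OF H *(1) *(3) ab])
    moreover have "a *\<^sub>R p + b *\<^sub>R p' = \<phi> (a *\<^sub>R ((x, u), r) + b *\<^sub>R ((x', u'), r'))"
      unfolding *(2,4) scaleR_Pair add_Pair \<phi> b by (simp add: blinfun.bilinear_simps algebra_simps)
    ultimately show "a *\<^sub>R p + b *\<^sub>R p' \<in> \<phi> ` H" by blast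
  qed
  moreover have "p u \<le> M"
    if M: "\<And>x v r. ((x, v), r) \<in> \<phi> ` H \<Longrightarrow> blinfun_apply u x + blinfun_apply p v - r \<le> M" for u p M
  proof -
    have "(p + canon x0) (u + u0) \<le> M + u x0 + p u0 + u0 x0"
    proof (rule conj)
      fix x v r assume "((x, v), r) \<in> H"
      then have "((x - x0, v - u0), r - u0 x - v x0 + u0 x0) \<in> \<phi> ` H"
        using \<phi>[of x v r] by (metis imageI)
      from M[OF this] show "(u + u0) x + (p + canon x0) v - r \<le> M + u x0 + p u0 + u0 x0"
        by (simp add: blinfun.bilinear_simps)
    qed
    then show ?thesis by (simp add: blinfun.bilinear_simps)
  qed
  ultimately obtain x u r where *: "((x, u), r) \<in> \<phi> ` H" "r + (norm x)\<^sup>2 / 2 + (norm u)\<^sup>2 / 2 < e"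
    using exists_small_with_squares[of "\<phi> ` H" e] e by blast
  then obtain y v s where "((y, v), s) \<in> H" "\<phi> ((y, v), s) = ((x, u), r)" by (metis imageE prod.exhaust)
  with *(2) show ?thesis by (auto simp: \<phi>_def intro!: exI[of _ y] exI[of _ v] exI[of _ s])
qed

text \<open>Iteration of the previous lemma. Convexity at midpoints makes the coupling of the
  difference of two almost minimal points almost nonnegative, hence consecutive points are close.\<close>

lemma exists_coupling_point_closed:
  fixes H :: "(('a::banach \<times> 'a dual) \<times> real) set"
  assumes H: "convex H" "closed H"
    and ge: "\<And>x u r. ((x, u), r) \<in> H \<Longrightarrow> blinfun_apply u x \<le> r"
    and conj: "\<And>u p M. (\<And>x v r. ((x, v), r) \<in> H \<Longrightarrow> blinfun_apply u x + blinfun_apply p v - r \<le> M)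
      \<Longrightarrow> blinfun_apply p u \<le> M"
  shows "\<exists>x u. ((x, u), blinfun_apply u x) \<in> H"
proof -
  define gap where "gap w = snd w - coupling (fst w)" for w :: "('a \<times> 'a dual) \<times> real"
  have duality: "- ((norm x)\<^sup>2 / 2 + (norm u)\<^sup>2 / 2) \<le> blinfun_apply u x" for x :: 'a and u :: "'a dual"
  proof -
    have "\<bar>u x\<bar> \<le> norm u * norm x" using norm_blinfun[of u x] by simp
    moreover have "norm u * norm x \<le> (norm x)\<^sup>2 / 2 + (norm u)\<^sup>2 / 2"
      using sum_squares_bound[of "norm u" "norm x"] by (simp add: field_simps)
    ultimately show ?thesis by linarith
  qed
  \<comment> \<open>At the midpoint the mean height minus the coupling equals the mean gap plus a
    quarter of the coupling of the difference, and this is nonnegative.\<close>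
  have sep: "- 2 * (a + b) \<le> blinfun_apply (u - v) (x - y)"
    if "((x, u), r) \<in> H" "gap ((x, u), r) < a" "((y, v), s) \<in> H" "gap ((y, v), s) < b" for x u r y v s a b
  proof -
    have "(1/2) *\<^sub>R ((x, u), r) + (1/2) *\<^sub>R ((y, v), s) \<in> H"
      using that by (intro convexD[OF H(1)]) auto
    then have "((1/2) *\<^sub>R u + (1/2) *\<^sub>R v) ((1/2) *\<^sub>R x + (1/2) *\<^sub>R y) \<le> (1/2) * r + (1/2) * s"
      by (intro ge) simp
    moreover have "r < u x + a" "s < v y + b" using that by (simp_all add: gap_def)
    ultimately show ?thesis by (simp add: blinfun.bilinear_simps algebra_simps)
  qed
  have step: "\<exists>w'. w' \<in> H \<and> gap w' < (1/4) ^ Suc n \<and> norm (fst w' - fst w) \<le> 3 * (1/2) ^ n"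
    if w: "w \<in> H" "gap w < (1/4) ^ n" for w n
  proof -
    obtain x0 u0 r0 where w_eq: "w = ((x0, u0), r0)" by (metis prod.exhaust)
    have pos: "0 < (1/4 :: real) ^ Suc n" by simp
    obtain x u r where xur: "((x, u), r) \<in> H"
      and lt: "r - u x + blinfun_apply (u - u0) (x - x0) + (norm (x - x0))\<^sup>2 / 2 + (norm (u - u0))\<^sup>2 / 2 < (1/4) ^ Suc n"
      using exists_near_coupling[OF H(1) conj pos] by blast
    have g: "gap ((x, u), r) < (1/4) ^ Suc n"
      using lt duality[of "x - x0" "u - u0"] by (simp add: gap_def)
    have "- 2 * ((1/4) ^ Suc n + (1/4) ^ n) \<le> (u - u0) (x - x0)"
      by (rule sep[OF xur g]) (use w w_eq in auto)
    then have "- (5/2 * (1/4) ^ n) \<le> blinfun_apply (u - u0) (x - x0)" by simp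
    then have "(norm (x - x0))\<^sup>2 / 2 + (norm (u - u0))\<^sup>2 / 2 \<le> 11/4 * (1/4) ^ n"
      using lt ge[OF xur] by simp
    moreover have "0 \<le> (1/4 :: real) ^ n" by simp
    \<comment> \<open>The bound obtained is \<open>11/2 * (1/4) ^ n\<close>; 9 is a larger perfect
      square, giving steps of size \<open>3 * (1/2) ^ n\<close>, which are summable.\<close>
    ultimately have "(norm (x - x0))\<^sup>2 + (norm (u - u0))\<^sup>2 \<le> 9 * (1/4) ^ n" by linarith
    also have "\<dots> = (3 * (1/2) ^ n)\<^sup>2" by (simp add: power_mult_distrib power2_eq_square flip: power_mult_distrib)
    finally have "norm (fst ((x, u), r) - fst w) \<le> 3 * (1/2) ^ n"
      by (simp add: w_eq norm_Pair real_le_lsqrt)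
    with xur g show ?thesis by blast
  qed
  have one: "(0::real) < 1" by simp
  obtain x u r where xur: "((x, u), r) \<in> H"
      and lt: "r - u x + blinfun_apply (u - 0) (x - 0) + (norm (x - 0))\<^sup>2 / 2 + (norm (u - 0))\<^sup>2 / 2 < 1"
    using exists_near_coupling[OF H(1) conj one, of 0 0] by blast
  then have "((x, u), r) \<in> H \<and> gap ((x, u), r) < (1/4) ^ 0"
    using duality[of x u] by (simp add: gap_def)
  then obtain w where w: "\<And>n. w n \<in> H \<and> gap (w n) < (1/4) ^ n"
    and wd: "\<And>n. norm (fst (w (Suc n)) - fst (w n)) \<le> 3 * (1/2) ^ n"
    using dependent_nat_choice[of "\<lambda>n w. w \<in> H \<and> gap w < (1/4) ^ n" "\<lambda>n w w'. norm (fst w' - fst w) \<le> 3 * (1/2) ^ n"]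
      step by (metis (no_types, lifting))
  define z where "z n = fst (w n)" for n
  have "summable (\<lambda>n. z (Suc n) - z n)"
  proof (rule summable_comparison_test)
    show "\<exists>N. \<forall>n\<ge>N. norm (z (Suc n) - z n) \<le> 3 * (1/2) ^ n" using wd by (auto simp: z_def)
    show "summable (\<lambda>n. 3 * (1/2) ^ n :: real)" by (intro summable_mult summable_geometric) simp
  qed
  then have "convergent (\<lambda>n. \<Sum>k<n. z (Suc k) - z k)" by (simp add: summable_iff_convergent)
  then have "convergent (\<lambda>n. (z n - z 0) + z 0)"
    unfolding sum_lessThan_telescope by (intro convergent_add convergent_const)
  then obtain l where l: "z \<longlonglongrightarrow> l" by (auto simp: convergent_def)
  obtain x u where l_eq: "l = (x, u)" by (cases l)
  have lim_c: "(\<lambda>n. coupling (z n)) \<longlonglongrightarrow> u x"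
    unfolding coupling_def using tendsto_fst[OF l] tendsto_snd[OF l] l_eq
    by (auto intro!: tendsto_intros)
  have "(\<lambda>n. gap (w n)) \<longlonglongrightarrow> 0"
  proof (rule tendsto_sandwich[OF _ _ tendsto_const])
    show "\<forall>\<^sub>F n in sequentially. 0 \<le> gap (w n)"
      using ge w by (intro always_eventually allI) (metis (no_types, opaque_lifting) coupling_Pair diff_ge_0_iff_ge gap_def prod.collapse)
    show "\<forall>\<^sub>F n in sequentially. gap (w n) \<le> (1/4) ^ n" using w by (simp add: less_imp_le)
    show "(\<lambda>n. (1/4) ^ n :: real) \<longlonglongrightarrow> 0" by (intro LIMSEQ_power_zero) simp
  qed
  then have "(\<lambda>n. gap (w n) + coupling (z n)) \<longlonglongrightarrow> 0 + u x" by (intro tendsto_add lim_c)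
  then have "(\<lambda>n. (z n, gap (w n) + coupling (z n))) \<longlonglongrightarrow> (l, u x)" using l by (intro tendsto_Pair) auto
  moreover have "(z n, gap (w n) + coupling (z n)) = w n" for n by (simp add: gap_def z_def)
  ultimately have "w \<longlonglongrightarrow> (l, u x)" by simp
  then have "(l, u x) \<in> H" using closed_sequentially[OF H(2)] w by blast
  then show ?thesis using l_eq by blast
qed

text \<open>A contact point exists only in the closure of \<open>H\<close>, to which both bounds
  pass. The subgradient inequality there, restricted to \<open>H\<close>, bounds the conjugate at
  this point by the coupling.\<close>

lemma exists_conjugate_le_coupling:
  fixes H :: "(('a::banach \<times> 'a dual) \<times> real) set"
  assumes H: "convex H"
    and ge: "\<And>x u r. ((x, u), r) \<in> H \<Longrightarrow> blinfun_apply u x \<le> r"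
    and conj: "\<And>u p M. (\<And>x v r. ((x, v), r) \<in> H \<Longrightarrow> blinfun_apply u x + blinfun_apply p v - r \<le> M)
      \<Longrightarrow> blinfun_apply p u \<le> M"
  shows "\<exists>x u. \<forall>y v r. ((y, v), r) \<in> H \<longrightarrow> blinfun_apply u y + blinfun_apply v x - r \<le> blinfun_apply u x"
proof -
  have clH: "convex (closure H)" "closed (closure H)" using H by (auto intro: convex_closure)
  have "closed {w :: ('a \<times> 'a dual) \<times> real. blinfun_apply (snd (fst w)) (fst (fst w)) \<le> snd w}"
    by (intro closed_Collect_le continuous_intros)
  then have "closure H \<subseteq> {w. blinfun_apply (snd (fst w)) (fst (fst w)) \<le> snd w}"
    using ge by (intro closure_minimal) auto
  then have ge': "u x \<le> r" if "((x, u), r) \<in> closure H" for x u r using that by auto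
  have conj': "p u \<le> M" if "\<And>x v r. ((x, v), r) \<in> closure H \<Longrightarrow> blinfun_apply u x + blinfun_apply p v - r \<le> M" for u p M
    using that closure_subset[of H] by (intro conj) blast
  obtain x u where "((x, u), blinfun_apply u x) \<in> closure H"
    using exists_coupling_point_closed[OF clH ge' conj'] by blast
  then have le: "blinfun_apply u y + v x - u x \<le> r" if "((y, v), r) \<in> H" for y v r
    using coupling_subgradient[OF clH(1) ge'] that closure_subset[of H] by blast
  have "blinfun_apply u y + v x - r \<le> u x" if "((y, v), r) \<in> H" for y v r
    using le[OF that] by linarith
  then show ?thesis by blast
qed

section \<open>Gossez type (D) operators and their representative functions\<close>

lemma representative_epigraph:
  assumes "representative S h"
  shows "convex {(z, r::real). h z \<le> ereal r}"
    and "h (x, u) \<le> ereal r \<Longrightarrow> blinfun_apply u x \<le> r"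
    and "(x, u) \<in> S \<Longrightarrow> h (x, u) = ereal (blinfun_apply u x)"
proof -
  show "convex {(z, r::real). h z \<le> ereal r}"
    using assms by (simp add: representative_def convex_ef_def)
  have "ereal (coupling (x, u)) \<le> h (x, u)" using assms by (auto simp: representative_def)
  then show "h (x, u) \<le> ereal r \<Longrightarrow> blinfun_apply u x \<le> r"
    by (metis coupling_Pair ereal_less_eq(3) order_trans)
  show "(x, u) \<in> S \<Longrightarrow> h (x, u) = ereal (blinfun_apply u x)"
    using assms by (auto simp: representative_def)
qed

lemma mem_edom: "z \<in> edom h \<longleftrightarrow> (\<exists>r. h z \<le> ereal r)"
  unfolding edom_def by (cases "h z") auto

text \<open>Equivalently, every representative function lies above the Fitzpatrick function of
  \<open>S\<close>.\<close>

lemma representative_subgradient: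
  assumes S: "representative S h" and xu: "(x, u) \<in> S" and yv: "h (y, v) \<le> ereal r"
  shows "blinfun_apply u y + blinfun_apply v x - blinfun_apply u x \<le> r"
  by (rule coupling_subgradient[OF representative_epigraph(1)[OF S]])
    (use representative_epigraph(2,3)[OF S] xu yv in auto)

text \<open>Type (D) carries the previous inequality from \<open>S\<close> to its Gossez closure by
  a limit along the filter. The delicate term is the coupling of the two moving components, where
  boundedness compensates for the merely weak* convergence of the first.\<close>

lemma gossez_subgradient:
  fixes S :: "('a::real_normed_vector \<times> 'a dual) set"
  assumes D: "gossez_D S" and S: "representative S h" and pu: "(p, u) \<in> gossez S"
    and yv: "h (y, v) \<le> ereal r"
  shows "blinfun_apply u y + blinfun_apply p v - blinfun_apply p u \<le> r"
proof -
  obtain F :: "('a \<times> 'a dual) filter" and M where F: "F \<noteq> bot"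
    and ev: "eventually (\<lambda>z. z \<in> S \<and> norm z \<le> M) F"
    and p: "\<And>f. ((\<lambda>z. blinfun_apply (canon (fst z)) f) \<longlongrightarrow> blinfun_apply p f) F"
    and u: "((\<lambda>z. snd z) \<longlongrightarrow> u) F"
    using D pu unfolding gossez_D_def by blast
  have "((\<lambda>z. M * norm (snd z - u)) \<longlongrightarrow> M * norm (u - u)) F"
    by (intro tendsto_intros u)
  then have "((\<lambda>z. M * norm (snd z - u)) \<longlongrightarrow> 0) F" by simp
  \<comment> \<open>Replacing \<open>snd z\<close> by its norm limit \<open>u\<close> costs at most
    \<open>M * norm (snd z - u)\<close>; after that only weak* convergence at the fixed
    \<open>u\<close> remains.\<close>
  moreover have "eventually (\<lambda>z. norm (blinfun_apply (snd z - u) (fst z)) \<le> M * norm (snd z - u)) F"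
    using ev
  proof eventually_elim
    case (elim z)
    have "norm (blinfun_apply (snd z - u) (fst z)) \<le> norm (snd z - u) * norm (fst z)" by (rule norm_blinfun)
    also have "\<dots> \<le> norm (snd z - u) * M"
      using elim norm_fst_le[of "fst z" "snd z"] by (intro mult_left_mono) auto
    finally show ?case by (simp add: mult.commute)
  qed
  ultimately have "((\<lambda>z. blinfun_apply (snd z - u) (fst z)) \<longlongrightarrow> 0) F" by (rule Lim_null_comparison[rotated])
  then have "((\<lambda>z. blinfun_apply (canon (fst z)) u + blinfun_apply (snd z - u) (fst z)) \<longlongrightarrow> p u + 0) F"
    by (intro tendsto_add p)
  then have uu: "((\<lambda>z. blinfun_apply (snd z) (fst z)) \<longlongrightarrow> p u) F"
    by (simp add: blinfun.bilinear_simps)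
  have "((\<lambda>z. blinfun_apply (snd z) y + blinfun_apply (canon (fst z)) v - blinfun_apply (snd z) (fst z))
      \<longlongrightarrow> u y + p v - p u) F"
    by (intro tendsto_diff tendsto_add uu p blinfun.tendsto u tendsto_const)
  moreover have "eventually (\<lambda>z. blinfun_apply (snd z) y + blinfun_apply (canon (fst z)) v - blinfun_apply (snd z) (fst z) \<le> r) F"
    using ev
  proof eventually_elim
    case (elim z)
    then show ?case using representative_subgradient[OF S _ yv, of "fst z" "snd z"] by simp
  qed
  ultimately show ?thesis by (rule tendsto_upperbound) (rule F)
qed

lemma maximal_monotone_nonempty:
  fixes S :: "('a::real_normed_vector \<times> 'a dual) set"
  assumes "maximal_monotone S"
  shows "S \<noteq> {}"
proof
  assume "S = {}"
  moreover have "monotone_op {(0 :: 'a, 0 :: 'a dual)}" by (simp add: monotone_op_def)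
  ultimately show False using assms unfolding maximal_monotone_def by blast
qed

text \<open>Such a point is monotonically related to all of \<open>S\<close>, so adding it preserves
  monotonicity.\<close>

lemma maximal_monotone_gossez:
  assumes S: "maximal_monotone S" and xu: "(canon x, u) \<in> gossez S"
  shows "(x, u) \<in> S"
proof -
  have 1: "0 \<le> (u - v) (x - y)" if "(y, v) \<in> S" for y v
  proof -
    have "0 \<le> (canon x - canon y) (u - v)" using xu that unfolding gossez_def by blast
    then show ?thesis by (simp add: blinfun.bilinear_simps)
  qed
  have 2: "0 \<le> (v - u) (y - x)" if "(y, v) \<in> S" for y v
    using 1[OF that] by (simp add: blinfun.bilinear_simps)
  have "monotone_op (insert (x, u) S)"
    unfolding monotone_op_def
  proof clarify
    fix y v y' v' assume "(y, v) \<in> insert (x, u) S" "(y', v') \<in> insert (x, u) S"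
    moreover have "0 \<le> (v - v') (y - y')" if "(y, v) \<in> S" "(y', v') \<in> S"
      using S that unfolding maximal_monotone_def monotone_op_def by blast
    ultimately show "0 \<le> (v - v') (y - y')" using 1[of y' v'] 2[of y v] by (elim insertE) simp_all
  qed
  then have "insert (x, u) S = S" using S unfolding maximal_monotone_def by blast
  then show ?thesis by blast
qed

text \<open>On \<open>S\<close> the function \<open>h\<close> equals the coupling, and the assumed
  bound rearranges to the inequality defining the closure. This turns multipliers into points of the
  Gossez closure.\<close>

lemma mem_gossezI:
  assumes S: "representative S h"
    and le: "\<And>y v r. h (y, v) \<le> ereal r \<Longrightarrow> blinfun_apply u y + blinfun_apply p v - r \<le> blinfun_apply p u"
  shows "(p, u) \<in> gossez S"
  unfolding gossez_def
proof clarify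
  fix y v assume "(y, v) \<in> S"
  then have "u y + p v - v y \<le> p u" using representative_epigraph(3)[OF S] by (intro le) simp
  then show "0 \<le> (p - canon y) (u - v)" by (simp add: blinfun.bilinear_simps)
qed

lemma bounded_affine_constant:
  fixes a b c :: real
  assumes "\<And>t. a + t * b \<le> c"
  shows "b = 0"
proof (rule ccontr)
  assume "b \<noteq> 0"
  then show False using assms[of "(c - a + 1) / b"] by simp
qed

text \<open>If the functional \<open>(p, q)\<close> is constant on \<open>T\<close> and \<open>q p = 0\<close>, then the whole line
  in direction \<open>(q, p)\<close> through a point of \<open>T\<close> lies in the Gossez closure.\<close>

lemma functional_constant_on_edom:
  fixes T :: "('b::real_normed_vector \<times> 'b dual) set"
  assumes D: "gossez_D T" and T: "representative T h"
    and const: "\<And>y w. (y, w) \<in> T \<Longrightarrow> blinfun_apply p y + blinfun_apply q w = \<alpha>"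
    and qp: "blinfun_apply q p = 0" and yw: "(y, w) \<in> edom h"
  shows "blinfun_apply p y + blinfun_apply q w = \<alpha>"
proof -
  have mono: "monotone_op T" and "T \<noteq> {}"
    using D maximal_monotone_nonempty by (auto simp: gossez_D_def maximal_monotone_def)
  then obtain y0 w0 where T0: "(y0, w0) \<in> T" by auto
  obtain r where r: "h (y, w) \<le> ereal r" using yw unfolding mem_edom by blast
  have line: "(canon y0 + t *\<^sub>R q, w0 + t *\<^sub>R p) \<in> gossez T" for t
    unfolding gossez_def
  proof clarify
    fix y' w' assume T': "(y', w') \<in> T"
    have "0 \<le> (w0 - w') (y0 - y')" using mono T0 T' unfolding monotone_op_def by blast
    moreover have "(canon y0 + t *\<^sub>R q - canon y') (w0 + t *\<^sub>R p - w')
        = (w0 - w') (y0 - y') + t * ((p y0 + q w0) - (p y' + q w')) + t * (t * q p)"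
      by (simp add: blinfun.bilinear_simps algebra_simps)
    ultimately show "0 \<le> (canon y0 + t *\<^sub>R q - canon y') (w0 + t *\<^sub>R p - w')"
      using const[OF T0] const[OF T'] qp by simp
  qed
  \<comment> \<open>The quadratic term vanishes by \<open>q p = 0\<close>, so the bound is affine in
    the unrestricted real \<open>t\<close> and its slope must be 0.\<close>
  have "w0 y + w y0 - w0 y0 + t * ((p y + q w) - (p y0 + q w0)) \<le> r" for t
    using gossez_subgradient[OF D T line r, of t] qp
    by (simp add: blinfun.bilinear_simps algebra_simps)
  then have "(p y + q w) - (p y0 + q w0) = 0" by (rule bounded_affine_constant)
  then show ?thesis using const[OF T0] by simp
qed

section \<open>Intrinsic cores and relative interiors\<close>

lemma affine_hull_msub:
  assumes "a \<in> D"
  shows "affine hull (msub D D) = (\<lambda>x. x - a) ` (affine hull D)"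
proof
  have aH: "a \<in> affine hull D" using assms by (rule hull_inc)
  have W: "subspace ((\<lambda>x. x - a) ` (affine hull D))"
    by (rule affine_diffs_subspace_subtract[OF affine_affine_hull aH])
  have "msub D D \<subseteq> (\<lambda>x. x - a) ` (affine hull D)"
  proof
    fix z assume "z \<in> msub D D"
    then obtain c d where "c \<in> D" "d \<in> D" "z = (c - a) - (d - a)" by (auto simp: msub_def)
    then show "z \<in> (\<lambda>x. x - a) ` (affine hull D)"
      using subspace_diff[OF W, of "c - a" "d - a"] by (simp add: hull_inc)
  qed
  then show "affine hull (msub D D) \<subseteq> (\<lambda>x. x - a) ` (affine hull D)"
    using W by (intro hull_minimal) (auto simp: subspace_imp_affine)
  have "(\<lambda>x. x - a) ` (affine hull D) = affine hull ((\<lambda>x. x - a) ` D)"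
    using affine_hull_translation[of "- a" D] by simp
  also have "\<dots> \<subseteq> affine hull (msub D D)"
    using assms by (intro hull_mono) (auto simp: msub_def)
  finally show "(\<lambda>x. x - a) ` (affine hull D) \<subseteq> affine hull (msub D D)" .
qed

lemma subspace_affine_hull_msub:
  assumes "a \<in> D"
  shows "subspace (affine hull (msub D D))"
  unfolding affine_hull_msub[OF assms]
  by (rule affine_diffs_subspace_subtract[OF affine_affine_hull hull_inc[OF assms]])

lemma closed_affine_hull_msub:
  fixes D :: "'c::real_normed_vector set"
  assumes "a \<in> D" "closed (affine hull D)"
  shows "closed (affine hull (msub D D))"
  unfolding affine_hull_msub[OF assms(1)] using assms(2) by (rule closed_translation_subtract)

lemma icr_subset: "0 \<in> affine hull (msub D D) \<Longrightarrow> icr D \<subseteq> D"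
proof
  fix u assume 0: "0 \<in> affine hull (msub D D)" and "u \<in> icr D"
  then obtain \<delta> :: real where "\<delta> > 0" "\<forall>t\<in>{0..\<delta>}. u + t *\<^sub>R 0 \<in> D" unfolding icr_def by blast
  then show "u \<in> D" by force
qed

lemma icr_mono:
  assumes "D \<noteq> {}" "D \<subseteq> D'" "affine hull D = affine hull D'"
  shows "icr D \<subseteq> icr D'"
proof -
  obtain a where "a \<in> D" using assms(1) by blast
  then have "affine hull (msub D D) = affine hull (msub D' D')"
    using affine_hull_msub[of a D] affine_hull_msub[of a D'] assms by auto
  then show ?thesis using assms(2) unfolding icr_def by (simp add: Collect_mono_iff) (meson subsetD)
qed

lemma rel_interior_subset_icr:
  fixes D :: "'c::real_normed_vector set"
  shows "rel_interior D \<subseteq> icr D"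
proof
  fix u assume "u \<in> rel_interior D"
  then obtain e where u: "u \<in> D" and e: "0 < e" "ball u e \<inter> affine hull D \<subseteq> D"
    unfolding mem_rel_interior_ball by blast
  show "u \<in> icr D"
    unfolding icr_def mem_Collect_eq
  proof
    fix x assume "x \<in> affine hull (msub D D)"
    then have x: "t *\<^sub>R x \<in> (\<lambda>x. x - u) ` (affine hull D)" for t
      using subspace_scale[OF subspace_affine_hull_msub[OF u]] affine_hull_msub[OF u] by blast
    define \<delta> where "\<delta> = (e / 2) / (norm x + 1)"
    have nx: "0 < norm x + 1" using norm_ge_zero[of x] by linarith
    have "0 < \<delta>" using e nx by (simp add: \<delta>_def)
    moreover have "u + t *\<^sub>R x \<in> D" if t: "t \<in> {0..\<delta>}" for t
    proof -
      have "t * norm x \<le> \<delta> * (norm x + 1)" using t by (intro mult_mono) auto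
      also have "\<dots> = e / 2" unfolding \<delta>_def using nx by (metis less_irrefl nonzero_eq_divide_eq)
      finally have "u + t *\<^sub>R x \<in> ball u e" using t e by (simp add: dist_norm)
      moreover have "u + t *\<^sub>R x \<in> affine hull D" using x[of t] by auto
      ultimately show ?thesis using e by blast
    qed
    ultimately show "\<exists>\<delta>>0. \<forall>t\<in>{0..\<delta>}. u + t *\<^sub>R x \<in> D" by blast
  qed
qed

text \<open>A point of \<open>D3\<close> outside the closed hull of \<open>D\<close> could be
  separated from it by a continuous functional that is constant on \<open>D1\<close> but takes
  another value at that point.\<close>

lemma affine_hull_eq_of_functionals:
  fixes D1 D D3 :: "'c::real_normed_vector set"
  assumes ne: "D1 \<noteq> {}" and sub: "D1 \<subseteq> D" "D \<subseteq> D3" and cl: "closed (affine hull D)"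
    and const: "\<And>L \<alpha> d. (\<And>d. d \<in> D1 \<Longrightarrow> blinfun_apply L d = \<alpha>) \<Longrightarrow> d \<in> D3 \<Longrightarrow> blinfun_apply L d = (\<alpha>::real)"
  shows "affine hull D = affine hull D3"
proof
  show "affine hull D \<subseteq> affine hull D3" by (rule hull_mono[OF sub(2)])
  obtain d1 where d1: "d1 \<in> D1" using ne by blast
  then have d1H: "d1 \<in> affine hull D" using sub by (blast intro: hull_inc)
  define W where "W = (\<lambda>x. x - d1) ` (affine hull D)"
  have W: "subspace W" "closed W" unfolding W_def
    using affine_diffs_subspace_subtract[OF affine_affine_hull d1H] closed_translation_subtract[OF cl] by auto
  have "D3 \<subseteq> affine hull D"
  proof (rule subsetI, rule ccontr)
    fix d3 assume d3: "d3 \<in> D3" "d3 \<notin> affine hull D"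
    then have "d3 - d1 \<notin> W" by (auto simp: W_def)
    then obtain L :: "'c \<Rightarrow>\<^sub>L real" where L: "\<And>w. w \<in> W \<Longrightarrow> L w = 0" "L (d3 - d1) \<noteq> 0"
      using subspace_separation[OF W] by blast
    have "L d = L d1" if "d \<in> D1" for d
    proof -
      have "d - d1 \<in> W" unfolding W_def using that sub by (blast intro: hull_inc)
      from L(1)[OF this] show ?thesis by (simp add: blinfun.bilinear_simps)
    qed
    from const[OF this d3(1)] L(2) show False by (simp add: blinfun.bilinear_simps)
  qed
  then show "affine hull D3 \<subseteq> affine hull D" by (intro hull_minimal affine_affine_hull)
qed

text \<open>If the hull of \<open>D\<close> is closed, the inclusions \<open>icr D <= icr D3 <=
  rel_interior D3 <= rel_interior D <= icr D\<close> close a cycle.\<close>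

lemma ic_ri_sandwich:
  fixes D1 D D3 :: "'c::real_normed_vector set"
  assumes ne: "D1 \<noteq> {}" and sub: "D1 \<subseteq> D" "D \<subseteq> D3"
    and hull: "closed (affine hull D) \<Longrightarrow> affine hull D = affine hull D3"
    and core: "closed (affine hull D3) \<Longrightarrow> icr D3 \<subseteq> D1 \<inter> rel_interior D3"
  shows "ic D = ic D3" "ri D = ic D3"
proof -
  have "ic D = ic D3 \<and> ri D = ic D3"
  proof (cases "closed (affine hull D)")
    case True
    have h: "affine hull D = affine hull D3" by (rule hull[OF True])
    with True have "closed (affine hull D3)" by simp
    note core = core[OF this]
    have "icr D3 \<subseteq> rel_interior D3" using core by blast
    moreover have "rel_interior D3 \<subseteq> rel_interior D"
    proof (rule rel_interior_maximal)
      show "rel_interior D3 \<subseteq> D" using rel_interior_subset_icr[of D3] core sub by blast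
      show "openin (top_of_set (affine hull D)) (rel_interior D3)"
        unfolding h by (rule openin_rel_interior)
    qed
    moreover have "rel_interior D \<subseteq> icr D" by (rule rel_interior_subset_icr)
    moreover have "icr D \<subseteq> icr D3" using ne sub by (intro icr_mono h) auto
    ultimately show ?thesis using True h by (auto simp: ic_def ri_def)
  next
    case False
    \<comment> \<open>A nonempty relative interior of \<open>D3\<close> would lie in
      \<open>D\<close> and already span the hull of \<open>D3\<close>, so the two hulls would agree
      and the hull of \<open>D\<close> would be closed.\<close>
    have "ic D3 = {}"
    proof (rule ccontr)
      assume "ic D3 \<noteq> {}"
      then have cl3: "closed (affine hull D3)" and "icr D3 \<noteq> {}" by (auto simp: ic_def split: if_splits)
      then have "rel_interior D3 \<noteq> {}" "rel_interior D3 \<subseteq> D"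
        using core[OF cl3] rel_interior_subset_icr[of D3] sub by blast+
      moreover have "affine hull (rel_interior D3) = affine hull D3"
        by (rule affine_hull_openin[OF openin_rel_interior \<open>rel_interior D3 \<noteq> {}\<close>])
      ultimately have "affine hull D = affine hull D3"
        using hull_mono[of "rel_interior D3" D affine] hull_mono[OF sub(2), of affine] by auto
      with cl3 False show False by simp
    qed
    with False show ?thesis by (simp add: ic_def ri_def)
  qed
  then show "ic D = ic D3" "ri D = ic D3" by auto
qed

section \<open>Lagrange multipliers\<close>

text \<open>The set \<open>V\<close> below is the epigraph of the value function of minimising the
  height over \<open>K\<close> subject to \<open>G z = g + v\<close>. The open mapping theorem
  bounds it above near 0 in \<open>W\<close>, and a subgradient at 0 is the multiplier.\<close>

lemma Lagrange_multiplier: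
  fixes C :: "nat \<Rightarrow> 'z::banach set" and G :: "'z \<Rightarrow> 'v::banach"
  assumes C: "\<And>n. closed (C n)" "\<And>n. convex (C n)" "\<And>n. bounded (C n)"
    and mono: "\<And>m n. m \<le> n \<Longrightarrow> C m \<subseteq> C n"
    and G: "bounded_linear G" and W: "subspace W" "closed W"
    and CW: "\<And>n z. z \<in> C n \<Longrightarrow> G z - g \<in> W"
    and core: "\<And>v. v \<in> W \<Longrightarrow> \<exists>\<delta>>0. \<forall>t\<in>{0..\<delta>}. \<exists>n. t *\<^sub>R v \<in> (\<lambda>z. G z - g) ` C n"
    and K: "convex K" "\<And>z s. (z, s) \<in> K \<Longrightarrow> \<exists>n. z \<in> C n"
    and bdd: "\<And>n. \<exists>M. \<forall>z\<in>C n. \<exists>s\<le>M. (z, s) \<in> K"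
    and m: "\<And>z s. (z, s) \<in> K \<Longrightarrow> G z = g \<Longrightarrow> m \<le> s"
  shows "\<exists>L :: 'v \<Rightarrow>\<^sub>L real. \<forall>z s. (z, s) \<in> K \<longrightarrow> m \<le> L (G z - g) + s"
proof -
  interpret G: bounded_linear G by fact
  have "\<exists>n e. 0 < e \<and> (\<forall>v\<in>W. norm v < e \<longrightarrow> v \<in> (\<lambda>z. G z - g) ` C n)"
    by (rule convex_exhaustion_open_mapping) (fact C mono G W CW core)+
  then obtain n e where e: "0 < e" and img: "\<forall>v\<in>W. norm v < e \<longrightarrow> v \<in> (\<lambda>z. G z - g) ` C n"
    by (elim exE conjE) (rule that)
  obtain M where M: "\<And>z. z \<in> C n \<Longrightarrow> \<exists>s\<le>M. (z, s) \<in> K" using bdd by blast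
  define V where "V = (\<lambda>(z, s). (G z - g, s)) ` K"
  have VI: "(G z - g, s) \<in> V" if "(z, s) \<in> K" for z s
    unfolding V_def by (rule image_eqI[OF _ that]) simp
  have "convex V"
  proof -
    have "V = (\<lambda>x. x - (g, 0)) ` ((\<lambda>(z, s). (G z, s)) ` K)"
      unfolding V_def by (auto simp: image_image intro!: image_eqI)
    moreover have "linear (\<lambda>(z, s). (G z, s :: real))"
      by (auto intro!: linearI simp: G.add G.scaleR)
    ultimately show ?thesis using K(1) by (simp add: convex_translation_subtract convex_linear_image)
  qed
  then obtain L :: "'v \<Rightarrow>\<^sub>L real" where L: "\<And>v r. (v, r) \<in> V \<Longrightarrow> m \<le> L v + r"
  proof (rule convex_subgradient[OF _ W(1), where d = "e / 2" and m = m and M = M])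
    show "v \<in> W" if vr: "(v, r) \<in> V" for v r
    proof -
      obtain z where z: "(z, r) \<in> K" "v = G z - g" using vr by (auto simp: V_def)
      then show ?thesis using K(2)[OF z(1)] CW by blast
    qed
    show "\<exists>r\<le>M. (v, r) \<in> V" if v: "v \<in> W" "norm v \<le> e / 2" for v
    proof -
      have "norm v < e" using v e by simp
      then obtain z where z: "z \<in> C n" "v = G z - g" using img v(1) by blast
      then obtain s where "s \<le> M" "(z, s) \<in> K" using M by blast
      then show ?thesis unfolding z(2) using VI by blast
    qed
    show "m \<le> r" if "(0, r) \<in> V" for r
      using that m by (auto simp: V_def)
    show "0 < e / 2" using e by simp
  qed blast
  show ?thesis
  proof (intro exI allI impI)
    fix z s assume "(z, s) \<in> K"
    then show "m \<le> L (G z - g) + s" by (intro L VI)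
  qed
qed

section \<open>The difference of the domains and the subspace\<close>

lemma adjoint_apply [simp]: "blinfun_apply (adjoint A w) x = blinfun_apply w (blinfun_apply A x)"
  by (simp add: adjoint_def)

text \<open>The pair \<open>(x2, w)\<close> parametrises \<open>E_set A\<close>. The component
  \<open>x1\<close> does not enter the value, since only the projection of the domain of
  \<open>hS\<close> to the dual occurs in the difference.\<close>

definition constraint ::
  "('a::real_normed_vector \<Rightarrow>\<^sub>L 'b::real_normed_vector) \<Rightarrow>
    (('a \<times> 'a dual) \<times> ('b \<times> 'b dual)) \<times> ('a \<times> 'b dual) \<Rightarrow> ('b \<times> 'b dual) \<times> 'a dual" where
  "constraint A = (\<lambda>(((x1, s), (y, t)), (x2, w)). ((y - A x2, t - w), s - adjoint A w))"

text \<open>Lower semicontinuity makes the sublevel sets closed; intersecting with balls makes them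
  bounded, as the halving series requires. Their union is the product of both domains with the
  parameter space.\<close>

definition domain_exhaustion ::
  "('a::real_normed_vector \<times> 'a dual \<Rightarrow> ereal) \<Rightarrow> ('b::real_normed_vector \<times> 'b dual \<Rightarrow> ereal) \<Rightarrow>
    nat \<Rightarrow> ((('a \<times> 'a dual) \<times> ('b \<times> 'b dual)) \<times> ('a \<times> 'b dual)) set" where
  "domain_exhaustion hS hT n =
    (({z. hS z \<le> ereal (real n)} \<inter> cball 0 (real n)) \<times> ({z. hT z \<le> ereal (real n)} \<inter> cball 0 (real n))) \<times> cball 0 (real n)"

lemma constraint_apply [simp]:
  "constraint A (((x1, s), (y, t)), (x2, w)) = ((y - A x2, t - w), s - adjoint A w)"
  by (simp add: constraint_def)

lemma bounded_linear_constraint: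
  fixes A :: "'a::real_normed_vector \<Rightarrow>\<^sub>L 'b::real_normed_vector"
  shows "bounded_linear (constraint A)"
proof -
  define c where "c z = ((fst (snd (fst z)) - blinfun_apply A (fst (snd z)), snd (snd (fst z)) - snd (snd z)),
      snd (fst (fst z)) - adjoint A (snd (snd z)))" for z :: "(('a \<times> 'a dual) \<times> ('b \<times> 'b dual)) \<times> ('a \<times> 'b dual)"
  have adj: "bounded_linear (adjoint A)"
    unfolding adjoint_def by (rule bounded_bilinear.bounded_linear_left[OF bounded_bilinear_blinfun_compose])
  note comps = bounded_linear_fst_comp bounded_linear_snd_comp bounded_linear_ident
  have "bounded_linear (\<lambda>z :: (('a \<times> 'a dual) \<times> ('b \<times> 'b dual)) \<times> ('a \<times> 'b dual). blinfun_apply A (fst (snd z)))"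
    by (rule bounded_linear_compose[OF blinfun.bounded_linear_right]) (intro comps)
  moreover have "bounded_linear (\<lambda>z :: (('a \<times> 'a dual) \<times> ('b \<times> 'b dual)) \<times> ('a \<times> 'b dual). adjoint A (snd (snd z)))"
    by (rule bounded_linear_compose[OF adj]) (intro comps)
  ultimately have "bounded_linear c"
    unfolding c_def by (intro bounded_linear_Pair bounded_linear_sub comps)
  moreover have "c = constraint A" by (auto simp: c_def constraint_def)
  ultimately show ?thesis by simp
qed

lemma domain_exhaustion:
  assumes S: "representative S hS" and T: "representative T hT"
  shows "closed (domain_exhaustion hS hT n)" "convex (domain_exhaustion hS hT n)"
    "bounded (domain_exhaustion hS hT n)" "m \<le> n \<Longrightarrow> domain_exhaustion hS hT m \<subseteq> domain_exhaustion hS hT n"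
proof -
  have cl: "closed {z. hS z \<le> ereal r}" "closed {z. hT z \<le> ereal r}" for r :: real
    using S T by (simp_all add: representative_def lsc_ef_def)
  have sublevel: "convex {z. h z \<le> ereal r}" if "convex {(z, r::real). h z \<le> ereal r}"
    for h :: "'c::real_vector \<Rightarrow> ereal" and r
  proof (rule convexI)
    fix z z' a b assume *: "z \<in> {z. h z \<le> ereal r}" "z' \<in> {z. h z \<le> ereal r}" "(0::real) \<le> a" "0 \<le> b" "a + b = 1"
    have "a *\<^sub>R (z, r) + b *\<^sub>R (z', r) \<in> {(z, r::real). h z \<le> ereal r}"
      using * by (intro convexD[OF that]) auto
    moreover have "a * r + b * r = r" using *(5) by (metis distrib_right mult_1)
    ultimately show "a *\<^sub>R z + b *\<^sub>R z' \<in> {z. h z \<le> ereal r}" by simp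
  qed
  show "closed (domain_exhaustion hS hT n)" unfolding domain_exhaustion_def
    by (intro closed_Times closed_Int cl closed_cball)
  show "convex (domain_exhaustion hS hT n)" unfolding domain_exhaustion_def
    by (intro convex_Times convex_Int convex_cball sublevel representative_epigraph(1)[OF S] representative_epigraph(1)[OF T])
  show "bounded (domain_exhaustion hS hT n)" unfolding domain_exhaustion_def
    by (intro bounded_Times bounded_Int disjI2 bounded_cball)
  have "h z \<le> ereal (real n)" if "h z \<le> ereal (real m)" "m \<le> n" for h :: "'c \<Rightarrow> ereal" and z
    using that by (meson ereal_less_eq(3) of_nat_le_iff order_trans)
  moreover have "cball 0 (real m) \<subseteq> cball (0 :: 'd :: real_normed_vector) (real n)" if "m \<le> n"
    using that by (intro subset_cball) simp
  ultimately show "domain_exhaustion hS hT m \<subseteq> domain_exhaustion hS hT n" if "m \<le> n"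
    using that unfolding domain_exhaustion_def by (intro Sigma_mono Int_mono) auto
qed

lemma mem_domain_exhaustion:
  assumes "zS \<in> edom hS" "zT \<in> edom hT"
  shows "\<exists>n. ((zS, zT), z) \<in> domain_exhaustion hS hT n"
proof -
  obtain rS rT where r: "hS zS \<le> ereal rS" "hT zT \<le> ereal rT" using assms unfolding mem_edom by blast
  obtain n where n: "max (max rS rT) (max (max (norm zS) (norm zT)) (norm z)) \<le> real n"
    using real_arch_simple by blast
  have "hS zS \<le> ereal (real n)" "hT zT \<le> ereal (real n)"
    using r n by (auto elim: order_trans)
  then show ?thesis using n by (auto simp: domain_exhaustion_def)
qed

lemma mem_msub_E_set:
  "d \<in> msub (P \<times> R) (E_set A) \<longleftrightarrow>
    (\<exists>y t s x w. (y, t) \<in> P \<and> s \<in> R \<and> d = ((y - blinfun_apply A x, t - w), s - adjoint A w))"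
  unfolding msub_def E_set_def by fastforce

lemma image_domain_exhaustion:
  "d \<in> msub (edom hT \<times> snd ` edom hS) (E_set A) \<longleftrightarrow> (\<exists>n. d \<in> constraint A ` domain_exhaustion hS hT n)"
proof
  assume "d \<in> msub (edom hT \<times> snd ` edom hS) (E_set A)"
  then obtain y t x1 s x w where *: "(y, t) \<in> edom hT" "(x1, s) \<in> edom hS"
    "d = ((y - blinfun_apply A x, t - w), s - adjoint A w)"
    unfolding mem_msub_E_set by fastforce
  obtain n where n: "(((x1, s), (y, t)), (x, w)) \<in> domain_exhaustion hS hT n"
    using mem_domain_exhaustion[OF *(2,1)] by blast
  have "d = constraint A (((x1, s), (y, t)), (x, w))" using *(3) by simp
  then have "d \<in> constraint A ` domain_exhaustion hS hT n" using n by (rule image_eqI)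
  then show "\<exists>n. d \<in> constraint A ` domain_exhaustion hS hT n" ..
next
  assume "\<exists>n. d \<in> constraint A ` domain_exhaustion hS hT n"
  then obtain n z where z: "z \<in> domain_exhaustion hS hT n" "d = constraint A z" by (elim exE imageE) (rule that)
  obtain x1 s y t x w where z_eq: "z = (((x1, s), (y, t)), (x, w))" by (metis surj_pair)
  note * = z[unfolded z_eq]
  have "hS (x1, s) \<le> ereal n" "hT (y, t) \<le> ereal n" using *(1) by (auto simp: domain_exhaustion_def)
  then have mem: "(x1, s) \<in> edom hS" "(y, t) \<in> edom hT" unfolding mem_edom by blast+
  have "s \<in> snd ` edom hS" by (rule image_eqI[OF _ mem(1)]) simp
  moreover have "d = ((y - blinfun_apply A x, t - w), s - adjoint A w)" using *(2) by simp
  ultimately show "d \<in> msub (edom hT \<times> snd ` edom hS) (E_set A)"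
    unfolding mem_msub_E_set using mem(2) by blast
qed

text \<open>Restates membership in \<open>icr D\<close> as the hypotheses of the open mapping and
  multiplier theorems.\<close>

lemma core_conditions:
  fixes hS :: "'a::banach \<times> 'a dual \<Rightarrow> ereal" and hT :: "'b::banach \<times> 'b dual \<Rightarrow> ereal"
    and A :: "'a \<Rightarrow>\<^sub>L 'b"
  defines "D \<equiv> msub (edom hT \<times> snd ` edom hS) (E_set A)"
  assumes cl: "closed (affine hull D)" and g: "g \<in> icr D" and ne: "D \<noteq> {}"
  defines "W \<equiv> affine hull (msub D D)"
  shows "subspace W" "closed W" "g \<in> D"
    and "z \<in> domain_exhaustion hS hT n \<Longrightarrow> constraint A z - g \<in> W"
    and "v \<in> W \<Longrightarrow> \<exists>\<delta>>0. \<forall>t\<in>{0..\<delta>}. \<exists>n. t *\<^sub>R v \<in> (\<lambda>z. constraint A z - g) ` domain_exhaustion hS hT n"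
proof -
  obtain a where a: "a \<in> D" using ne by blast
  show W: "subspace W" "closed W"
    unfolding W_def using subspace_affine_hull_msub[OF a] closed_affine_hull_msub[OF a cl] by auto
  show gD: "g \<in> D" using icr_subset[of "D"] g subspace_0[OF W(1)] by (auto simp: W_def)
  show "constraint A z - g \<in> W" if "z \<in> domain_exhaustion hS hT n"
  proof -
    have "constraint A z \<in> D" unfolding D_def image_domain_exhaustion using that by blast
    then have "constraint A z - g \<in> msub D D" unfolding msub_def using gD by blast
    then show ?thesis unfolding W_def by (rule hull_inc)
  qed
  show "\<exists>\<delta>>0. \<forall>t\<in>{0..\<delta>}. \<exists>n. t *\<^sub>R v \<in> (\<lambda>z. constraint A z - g) ` domain_exhaustion hS hT n" if v: "v \<in> W"
  proof -
    obtain \<delta> :: real where \<delta>: "\<delta> > 0" "\<And>t. t \<in> {0..\<delta>} \<Longrightarrow> g + t *\<^sub>R v \<in> D"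
      using g v unfolding icr_def W_def by blast
    have "\<exists>n. t *\<^sub>R v \<in> (\<lambda>z. constraint A z - g) ` domain_exhaustion hS hT n" if t: "t \<in> {0..\<delta>}" for t
    proof -
      obtain n where "g + t *\<^sub>R v \<in> constraint A ` domain_exhaustion hS hT n"
        using \<delta>(2)[OF t] unfolding D_def image_domain_exhaustion ..
      then obtain z where z: "g + t *\<^sub>R v = constraint A z" "z \<in> domain_exhaustion hS hT n" by (rule imageE)
      have "t *\<^sub>R v = constraint A z - g" unfolding z(1)[symmetric] by simp
      then have "t *\<^sub>R v \<in> (\<lambda>z. constraint A z - g) ` domain_exhaustion hS hT n" using z(2) by (rule image_eqI)
      then show ?thesis ..
    qed
    then show ?thesis using \<delta>(1) by blast
  qed
qed

lemma icr_subset_rel_interior: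
  fixes hS :: "'a::banach \<times> 'a dual \<Rightarrow> ereal" and hT :: "'b::banach \<times> 'b dual \<Rightarrow> ereal"
    and A :: "'a \<Rightarrow>\<^sub>L 'b"
  defines "D \<equiv> msub (edom hT \<times> snd ` edom hS) (E_set A)"
  assumes S: "representative S hS" and T: "representative T hT"
    and cl: "closed (affine hull D)" and ne: "D \<noteq> {}"
  shows "icr D \<subseteq> rel_interior D"
proof
  fix g assume g: "g \<in> icr D"
  note core = core_conditions[OF cl[unfolded D_def] g[unfolded D_def] ne[unfolded D_def], folded D_def]
  have "\<exists>n e. 0 < e \<and> (\<forall>v\<in>affine hull (msub D D). norm v < e \<longrightarrow>
      v \<in> (\<lambda>z. constraint A z - g) ` domain_exhaustion hS hT n)"
    by (rule convex_exhaustion_open_mapping)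
      (fact domain_exhaustion[OF S T] bounded_linear_constraint core(1,2,4,5))+
  then obtain n e where e: "0 < e" and img: "\<forall>v\<in>affine hull (msub D D). norm v < e \<longrightarrow>
      v \<in> (\<lambda>z. constraint A z - g) ` domain_exhaustion hS hT n"
    by (elim exE conjE) (rule that)
  have "ball g e \<inter> affine hull D \<subseteq> D"
  proof
    fix d assume d: "d \<in> ball g e \<inter> affine hull D"
    then have "d - g \<in> affine hull (msub D D)" using affine_hull_msub[OF core(3)] by blast
    moreover have "norm (d - g) < e" using d by (simp add: dist_norm norm_minus_commute)
    ultimately have "d - g \<in> (\<lambda>z. constraint A z - g) ` domain_exhaustion hS hT n" using img by simp
    then obtain z where z: "d - g = constraint A z - g" "z \<in> domain_exhaustion hS hT n" by (rule imageE)
    have "d = constraint A z" using z(1) by simp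
    then have "d \<in> constraint A ` domain_exhaustion hS hT n" using z(2) by (rule image_eqI)
    then show "d \<in> D" unfolding D_def image_domain_exhaustion ..
  qed
  then show "g \<in> rel_interior D" unfolding mem_rel_interior_ball using core(3) e by blast
qed

section \<open>The core of the large difference lies in the small one\<close>

text \<open>Real-valued form of the strong representation property: any real bound of the terms in
  the conjugate bounds the coupling.\<close>

lemma strong_representative_conjugate:
  fixes h :: "'a::real_normed_vector \<times> 'a dual \<Rightarrow> ereal"
  assumes S: "strong_representative S h"
    and le: "\<And>x v r. h (x, v) \<le> ereal r \<Longrightarrow> blinfun_apply u x + blinfun_apply p v - r \<le> B"
  shows "blinfun_apply p u \<le> B"
proof -
  have "ereal (blinfun_apply p u) \<le> conjugate h (u, p)" using S unfolding strong_representative_def by blast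
  also have "\<dots> \<le> ereal B"
    unfolding conjugate_def prod.case
  proof (rule SUP_least)
    fix z :: "'a \<times> 'a dual"
    obtain x v where z: "z = (x, v)" by (cases z)
    \<comment> \<open>This excludes the value minus infinity; where \<open>h z\<close> is plus
      infinity the term is trivially below \<open>B\<close>.\<close>
    have "ereal (coupling z) \<le> h z" using S unfolding strong_representative_def representative_def by blast
    then show "ereal (blinfun_apply u (fst z) + blinfun_apply p (snd z)) - h z \<le> ereal B"
      using le[of x v] by (cases "h z") (auto simp: z)
  qed
  finally show ?thesis by simp
qed

text \<open>Premise \<open>le\<close> bounds a constrained minimum below by \<open>- M\<close>. The
  multiplier removes the constraints, and the free variables \<open>x2\<close> and \<open>w\<close>
  then force their coefficients to vanish: this yields \<open>u = adjoint A v\<close> and the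
  formula for \<open>Q\<close>. What is left separates into a part for \<open>hS\<close> and a part
  for \<open>hT\<close>.\<close>

lemma difference_multiplier:
  fixes hS :: "'a::banach \<times> 'a dual \<Rightarrow> ereal" and hT :: "'b::banach \<times> 'b dual \<Rightarrow> ereal"
    and A :: "'a \<Rightarrow>\<^sub>L 'b"
  defines "D \<equiv> msub (edom hT \<times> snd ` edom hS) (E_set A)"
  assumes S: "representative S hS" and T: "representative T hT"
    and cl: "closed (affine hull D)" and g: "((b, a), c) \<in> icr D" and ne: "D \<noteq> {}"
    and le: "\<And>x1 x2 w rS rT. hS (x1, c + adjoint A w) \<le> ereal rS \<Longrightarrow>
      hT (b + blinfun_apply A x2, a + w) \<le> ereal rT \<Longrightarrow>
      blinfun_apply u (x1 + x2) + blinfun_apply p (adjoint A w)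
        - (rS - blinfun_apply c x1 + rT - blinfun_apply w b - blinfun_apply a (blinfun_apply A x2) - blinfun_apply a b) \<le> M"
  obtains v Q R where "u = adjoint A v"
    "\<And>w. blinfun_apply Q w = blinfun_apply w b + blinfun_apply (p - R) (adjoint A w)"
    "\<And>x s rS y t rT. hS (x, s) \<le> ereal rS \<Longrightarrow> hT (y, t) \<le> ereal rT \<Longrightarrow>
      (blinfun_apply (c + u) x + blinfun_apply R s - rS) + (blinfun_apply (a + v) y + blinfun_apply Q t - rT)
        \<le> M + blinfun_apply v b + blinfun_apply Q a + blinfun_apply R c"
proof -
  note core = core_conditions[OF cl[unfolded D_def] g[unfolded D_def] ne[unfolded D_def], folded D_def]
  \<comment> \<open>On the constraint set \<open>rS + rT + l z - a b\<close> is the negative of the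
    left-hand side of \<open>le\<close>.\<close>
  define l :: "(('a \<times> 'a dual) \<times> ('b \<times> 'b dual)) \<times> ('a \<times> 'b dual) \<Rightarrow> real" where
    "l z = - ((c + u) (fst (fst (fst z)))) - u (fst (snd z)) - a (A (fst (snd z)))
      - blinfun_apply (snd (snd z)) b - p (adjoint A (snd (snd z)))" for z
  have l_bl: "bounded_linear l"
  proof -
    note comps = bounded_linear_fst_comp bounded_linear_snd_comp bounded_linear_ident
    have adj: "bounded_linear (adjoint A)"
      unfolding adjoint_def by (rule bounded_bilinear.bounded_linear_left[OF bounded_bilinear_blinfun_compose])
    have 1: "bounded_linear (\<lambda>z :: (('a \<times> 'a dual) \<times> ('b \<times> 'b dual)) \<times> ('a \<times> 'b dual). (c + u) (fst (fst (fst z))))"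
      by (rule bounded_linear_compose[OF blinfun.bounded_linear_right]) (intro comps)
    have 2: "bounded_linear (\<lambda>z :: (('a \<times> 'a dual) \<times> ('b \<times> 'b dual)) \<times> ('a \<times> 'b dual). u (fst (snd z)))"
      by (rule bounded_linear_compose[OF blinfun.bounded_linear_right]) (intro comps)
    have 3: "bounded_linear (\<lambda>z :: (('a \<times> 'a dual) \<times> ('b \<times> 'b dual)) \<times> ('a \<times> 'b dual). a (A (fst (snd z))))"
      by (rule bounded_linear_compose[OF blinfun.bounded_linear_right],
          rule bounded_linear_compose[OF blinfun.bounded_linear_right]) (intro comps)
    have 4: "bounded_linear (\<lambda>z :: (('a \<times> 'a dual) \<times> ('b \<times> 'b dual)) \<times> ('a \<times> 'b dual). blinfun_apply (snd (snd z)) b)"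
      by (rule bounded_linear_compose[OF blinfun.bounded_linear_left]) (intro comps)
    have 5: "bounded_linear (\<lambda>z :: (('a \<times> 'a dual) \<times> ('b \<times> 'b dual)) \<times> ('a \<times> 'b dual). p (adjoint A (snd (snd z))))"
      by (rule bounded_linear_compose[OF blinfun.bounded_linear_right],
          rule bounded_linear_compose[OF adj]) (intro comps)
    show ?thesis unfolding l_def
      by (intro bounded_linear_sub bounded_linear_minus 1 2 3 4 5)
  qed
  then interpret l: bounded_linear l .
  define K where "K = {(z, r). \<exists>rS rT. hS (fst (fst z)) \<le> ereal rS \<and> hT (snd (fst z)) \<le> ereal rT \<and> r = rS + rT + l z - a b}"
  have KI: "(z, rS + rT + l z - a b) \<in> K" if "hS (fst (fst z)) \<le> ereal rS" "hT (snd (fst z)) \<le> ereal rT" for z rS rT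
    using that unfolding K_def by blast
  have K_convex: "convex K"
  proof (rule convexI)
    fix k k' \<mu> \<nu>
    assume k: "k \<in> K" "k' \<in> K" and \<mu>: "(0::real) \<le> \<mu>" "0 \<le> \<nu>" "\<mu> + \<nu> = 1"
    obtain z rS rT where 1: "k = (z, rS + rT + l z - a b)" "hS (fst (fst z)) \<le> ereal rS" "hT (snd (fst z)) \<le> ereal rT"
      using k(1) unfolding K_def by blast
    obtain z' rS' rT' where 2: "k' = (z', rS' + rT' + l z' - a b)" "hS (fst (fst z')) \<le> ereal rS'" "hT (snd (fst z')) \<le> ereal rT'"
      using k(2) unfolding K_def by blast
    have "\<mu> *\<^sub>R (fst (fst z), rS) + \<nu> *\<^sub>R (fst (fst z'), rS') \<in> {(z, r::real). hS z \<le> ereal r}"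
      using 1 2 by (intro convexD[OF representative_epigraph(1)[OF S] _ _ \<mu>]) auto
    then have S': "hS (fst (fst (\<mu> *\<^sub>R z + \<nu> *\<^sub>R z'))) \<le> ereal (\<mu> * rS + \<nu> * rS')" by simp
    have "\<mu> *\<^sub>R (snd (fst z), rT) + \<nu> *\<^sub>R (snd (fst z'), rT') \<in> {(z, r::real). hT z \<le> ereal r}"
      using 1 2 by (intro convexD[OF representative_epigraph(1)[OF T] _ _ \<mu>]) auto
    then have T': "hT (snd (fst (\<mu> *\<^sub>R z + \<nu> *\<^sub>R z'))) \<le> ereal (\<mu> * rT + \<nu> * rT')" by simp
    have \<nu>: "\<nu> = 1 - \<mu>" using \<mu> by simp
    have "\<mu> *\<^sub>R k + \<nu> *\<^sub>R k' = (\<mu> *\<^sub>R z + \<nu> *\<^sub>R z', (\<mu> * rS + \<nu> * rS') + (\<mu> * rT + \<nu> * rT') + l (\<mu> *\<^sub>R z + \<nu> *\<^sub>R z') - a b)"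
      unfolding 1(1) 2(1) l.add l.scaleR by (simp add: \<nu> algebra_simps)
    then show "\<mu> *\<^sub>R k + \<nu> *\<^sub>R k' \<in> K" using KI[OF S' T'] by simp
  qed
  have "\<exists>L :: (('b \<times> 'b dual) \<times> 'a dual) \<Rightarrow>\<^sub>L real. \<forall>z r. (z, r) \<in> K \<longrightarrow> - M \<le> L (constraint A z - ((b, a), c)) + r"
  proof (rule Lagrange_multiplier[where C = "domain_exhaustion hS hT" and G = "constraint A" and K = K
        and W = "affine hull (msub D D)" and g = "((b, a), c)" and m = "- M"])
    show "\<exists>n. z \<in> domain_exhaustion hS hT n" if zr: "(z, r) \<in> K" for z r
    proof -
      have "fst (fst z) \<in> edom hS" "snd (fst z) \<in> edom hT" using zr unfolding K_def mem_edom by blast+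
      from mem_domain_exhaustion[OF this, of "snd z"] show ?thesis by simp
    qed
    show "\<exists>B. \<forall>z\<in>domain_exhaustion hS hT n. \<exists>r\<le>B. (z, r) \<in> K" for n
    proof -
      have "bounded (l ` domain_exhaustion hS hT n)"
        by (rule bounded_linear_image[OF domain_exhaustion(3)[OF S T] l_bl])
      then obtain B where B: "\<forall>r\<in>l ` domain_exhaustion hS hT n. norm r \<le> B" unfolding bounded_iff by blast
      have "\<exists>r\<le>real n + real n + B - a b. (z, r) \<in> K" if z: "z \<in> domain_exhaustion hS hT n" for z
      proof -
        have "(z, real n + real n + l z - a b) \<in> K"
          using z by (intro KI) (auto simp: domain_exhaustion_def)
        moreover have "real n + real n + l z - a b \<le> real n + real n + B - a b" using B z by auto
        ultimately show ?thesis by blast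
      qed
      then show ?thesis by blast
    qed
    show "- M \<le> r" if zr: "(z, r) \<in> K" and zg: "constraint A z = ((b, a), c)" for z r
    proof -
      obtain x1 s y t x2 w where z: "z = (((x1, s), (y, t)), (x2, w))" by (metis surj_pair)
      have eqs: "y = b + A x2" "t = a + w" "s = c + adjoint A w" using zg unfolding z by (auto simp: algebra_simps)
      obtain rS rT where r: "hS (x1, s) \<le> ereal rS" "hT (y, t) \<le> ereal rT" "r = rS + rT + l z - a b"
        using zr unfolding K_def z by auto
      show ?thesis using le[OF r(1)[unfolded eqs] r(2)[unfolded eqs]] unfolding r(3)
        by (simp add: l_def z blinfun.bilinear_simps)
    qed
  qed (fact domain_exhaustion[OF S T] bounded_linear_constraint core(1,2,4,5) K_convex)+
  then obtain L :: "(('b \<times> 'b dual) \<times> 'a dual) \<Rightarrow>\<^sub>L real"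
    where L: "\<And>z r. (z, r) \<in> K \<Longrightarrow> - M \<le> L (constraint A z - ((b, a), c)) + r" by blast
  obtain L' R' where L': "\<And>z s. L (z, s) = blinfun_apply L' z + blinfun_apply R' s"
    using blinfun_prod_split[of L] by metis
  obtain p' q' where L'': "\<And>y t. L' (y, t) = blinfun_apply p' y + blinfun_apply q' t"
    using blinfun_prod_split[of L'] by metis
  have main: "- M \<le> p' (y - A x2 - b) + q' (t - w - a) + R' (s - adjoint A w - c) + rS + rT
      - (c + u) x1 - u x2 - a (A x2) - w b - p (adjoint A w) - a b"
    if r: "hS (x1, s) \<le> ereal rS" "hT (y, t) \<le> ereal rT" for x1 s rS y t rT x2 w
  proof -
    define z where "z = (((x1, s), (y, t)), (x2, w))"
    have "(z, rS + rT + l z - a b) \<in> K" using r by (intro KI) (simp_all add: z_def)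
    from L[OF this] show ?thesis by (simp add: z_def l_def L' L'')
  qed
  have "\<exists>y t x1 s. (y, t) \<in> edom hT \<and> (x1, s) \<in> edom hS"
    using ne unfolding D_def msub_def by fastforce
  then obtain x0 s0 rS0 y0 t0 rT0 where r0: "hS (x0, s0) \<le> ereal rS0" "hT (y0, t0) \<le> ereal rT0"
    unfolding mem_edom by blast
  \<comment> \<open>The coefficient of \<open>x2\<close> is \<open>- p' o A - u - a o A\<close>;
    requiring it to vanish dictates this \<open>v\<close>.\<close>
  define v where "v = - p' - a"
  have u_eq: "u x = v (A x)" for x
  proof -
    define k where "k = p' (A x) + u x + a (A x)"
    define d where "d = p' (y0 - b) + q' (t0 - a) + R' (s0 - c) + rS0 + rT0 - (c + u) x0 - a b"
    have "0 + n * k \<le> d + M" for n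
      using main[OF r0, of "n *\<^sub>R x" 0] unfolding k_def d_def
      by (simp add: blinfun.bilinear_simps algebra_simps adjoint_def)
    then have "k = 0" by (rule bounded_affine_constant)
    then show ?thesis by (simp add: k_def v_def blinfun.bilinear_simps)
  qed
  have q_eq: "- (q' w) = w b + p (adjoint A w) + R' (adjoint A w)" for w
  proof -
    define k where "k = q' w + w b + p (adjoint A w) + R' (adjoint A w)"
    define d where "d = p' (y0 - b) + q' (t0 - a) + R' (s0 - c) + rS0 + rT0 - (c + u) x0 - a b"
    have adj: "adjoint A (n *\<^sub>R w) = n *\<^sub>R adjoint A w" for n
      by (rule blinfun_eqI) (simp add: blinfun.bilinear_simps)
    have "0 + n * k \<le> d + M" for n
      using main[OF r0, of 0 "n *\<^sub>R w"] unfolding k_def d_def adj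
      by (simp add: blinfun.bilinear_simps algebra_simps)
    then have "k = 0" by (rule bounded_affine_constant)
    then show ?thesis by (simp add: k_def)
  qed
  show ?thesis
  proof
    show "u = adjoint A v" by (rule blinfun_eqI) (simp add: u_eq)
    show "(- q') w = w b + (p - (- R')) (adjoint A w)" for w
      using q_eq[of w] by (simp add: blinfun.bilinear_simps)
    have adj0: "adjoint A 0 = 0" by (rule blinfun_eqI) simp
    show "((c + u) x + (- R') s - rS) + ((a + v) y + (- q') t - rT) \<le> M + v b + (- q') a + (- R') c"
      if "hS (x, s) \<le> ereal rS" "hT (y, t) \<le> ereal rT" for x s rS y t rT
      using main[OF that, of 0 0] by (simp add: v_def adj0 blinfun.bilinear_simps)
  qed
qed

text \<open>Multipliers serve twice. For an arbitrary bound \<open>M\<close> they show that the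
  conjugate lies above the coupling. At the contact point the joint bound equals the sum of the two
  lower bounds from strong representation, so each operator attains its own bound
  separately.\<close>

lemma icr_subset_operator_difference:
  fixes S :: "('a::banach \<times> 'a dual) set" and T :: "('b::banach \<times> 'b dual) set"
    and hS :: "'a \<times> 'a dual \<Rightarrow> ereal" and hT :: "'b \<times> 'b dual \<Rightarrow> ereal"
    and A :: "'a \<Rightarrow>\<^sub>L 'b"
  defines "D \<equiv> msub (edom hT \<times> snd ` edom hS) (E_set A)"
  assumes S_max: "maximal_monotone S" and T_max: "maximal_monotone T"
    and hS: "strong_representative S hS" and hT: "strong_representative T hT"
    and dom_closure: "dom_op (gossez S) \<subseteq> range canon"
    and cl: "closed (affine hull D)" and ne: "D \<noteq> {}"
  shows "icr D \<subseteq> msub (T \<times> ran_op S) (E_set A)"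
proof
  fix g assume "g \<in> icr D"
  moreover obtain b a c where g: "g = ((b, a), c)" by (metis surj_pair)
  ultimately have gi: "((b, a), c) \<in> icr D" by simp
  have S: "representative S hS" and T: "representative T hT"
    using hS hT by (simp_all add: strong_representative_def)
  note mult = difference_multiplier[OF S T cl[unfolded D_def] gi[unfolded D_def] ne[unfolded D_def]]
  define feasible where "feasible = (\<lambda>x1 x2 w rS rT. hS (x1, c + adjoint A w) \<le> ereal rS \<and>
    hT (b + blinfun_apply A x2, a + w) \<le> ereal rT)"
  define val where "val x1 x2 w rS rT = rS - blinfun_apply c x1 + rT - blinfun_apply w b
    - blinfun_apply a (blinfun_apply A x2) - blinfun_apply a b" for x1 x2 w and rS rT :: real
  \<comment> \<open>the epigraph of the function representing the parallel sum, before taking the infimum\<close>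
  define H where "H = {((x1 + x2, adjoint A w), val x1 x2 w rS rT) | x1 x2 w rS rT. feasible x1 x2 w rS rT}"
  have HI: "((x1 + x2, adjoint A w), val x1 x2 w rS rT) \<in> H" if "feasible x1 x2 w rS rT" for x1 x2 w rS rT
    using that unfolding H_def by blast
  have adj_lin: "adjoint A (\<mu> *\<^sub>R w + \<nu> *\<^sub>R w') = \<mu> *\<^sub>R adjoint A w + \<nu> *\<^sub>R adjoint A w'" for \<mu> \<nu> w w'
    by (rule blinfun_eqI) (simp add: blinfun.bilinear_simps)
  have H_convex: "convex H"
  proof (rule convexI)
    fix k k' \<mu> \<nu>
    assume k: "k \<in> H" "k' \<in> H" and \<mu>: "(0::real) \<le> \<mu>" "0 \<le> \<nu>" "\<mu> + \<nu> = 1"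
    obtain x1 x2 w rS rT where 1: "k = ((x1 + x2, adjoint A w), val x1 x2 w rS rT)" "feasible x1 x2 w rS rT"
      using k(1) unfolding H_def by blast
    obtain x1' x2' w' rS' rT' where 2: "k' = ((x1' + x2', adjoint A w'), val x1' x2' w' rS' rT')" "feasible x1' x2' w' rS' rT'"
      using k(2) unfolding H_def by blast
    have \<nu>: "\<nu> = 1 - \<mu>" using \<mu> by simp
    have "\<mu> *\<^sub>R ((x1, c + adjoint A w), rS) + \<nu> *\<^sub>R ((x1', c + adjoint A w'), rS') \<in> {(z, r::real). hS z \<le> ereal r}"
      using 1(2) 2(2) by (intro convexD[OF representative_epigraph(1)[OF S] _ _ \<mu>]) (auto simp: feasible_def)
    moreover have "\<mu> *\<^sub>R (c + adjoint A w) + \<nu> *\<^sub>R (c + adjoint A w') = c + adjoint A (\<mu> *\<^sub>R w + \<nu> *\<^sub>R w')"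
      unfolding adj_lin by (simp add: \<nu> algebra_simps)
    moreover have "\<mu> *\<^sub>R ((b + A x2, a + w), rT) + \<nu> *\<^sub>R ((b + A x2', a + w'), rT') \<in> {(z, r::real). hT z \<le> ereal r}"
      using 1(2) 2(2) by (intro convexD[OF representative_epigraph(1)[OF T] _ _ \<mu>]) (auto simp: feasible_def)
    moreover have "\<mu> *\<^sub>R (b + A x2) + \<nu> *\<^sub>R (b + A x2') = b + A (\<mu> *\<^sub>R x2 + \<nu> *\<^sub>R x2')"
      "\<mu> *\<^sub>R (a + w) + \<nu> *\<^sub>R (a + w') = a + (\<mu> *\<^sub>R w + \<nu> *\<^sub>R w')"
      by (simp_all add: \<nu> blinfun.bilinear_simps algebra_simps)
    ultimately have feas: "feasible (\<mu> *\<^sub>R x1 + \<nu> *\<^sub>R x1') (\<mu> *\<^sub>R x2 + \<nu> *\<^sub>R x2') (\<mu> *\<^sub>R w + \<nu> *\<^sub>R w')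
        (\<mu> * rS + \<nu> * rS') (\<mu> * rT + \<nu> * rT')"
      unfolding feasible_def by simp
    have val_eq: "val (\<mu> *\<^sub>R x1 + \<nu> *\<^sub>R x1') (\<mu> *\<^sub>R x2 + \<nu> *\<^sub>R x2') (\<mu> *\<^sub>R w + \<nu> *\<^sub>R w')
        (\<mu> * rS + \<nu> * rS') (\<mu> * rT + \<nu> * rT') = \<mu> * val x1 x2 w rS rT + \<nu> * val x1' x2' w' rS' rT'"
      unfolding val_def \<nu> by (simp add: blinfun.bilinear_simps algebra_simps)
    have sum_eq: "(\<mu> *\<^sub>R x1 + \<nu> *\<^sub>R x1') + (\<mu> *\<^sub>R x2 + \<nu> *\<^sub>R x2') = \<mu> *\<^sub>R (x1 + x2) + \<nu> *\<^sub>R (x1' + x2')"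
      by (simp add: algebra_simps)
    show "\<mu> *\<^sub>R k + \<nu> *\<^sub>R k' \<in> H"
      using HI[OF feas] unfolding 1(1) 2(1) val_eq sum_eq adj_lin by simp
  qed
  \<comment> \<open>The shift terms in \<open>val\<close> are those for which the coupling bounds of
    \<open>hS\<close> and \<open>hT\<close> add up to the coupling of
    \<open>(x1 + x2, adjoint A w)\<close>.\<close>
  have H_ge: "v x \<le> r" if "((x, v), r) \<in> H" for x v r
  proof -
    obtain x1 x2 w rS rT where *: "x = x1 + x2" "v = adjoint A w" "r = val x1 x2 w rS rT" "feasible x1 x2 w rS rT"
      using \<open>((x, v), r) \<in> H\<close> unfolding H_def by blast
    have "(c + adjoint A w) x1 \<le> rS" "(a + w) (b + A x2) \<le> rT"
      using *(4) representative_epigraph(2)[OF S] representative_epigraph(2)[OF T] unfolding feasible_def by blast+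
    then show ?thesis unfolding *(1,2,3) val_def by (simp add: blinfun.bilinear_simps)
  qed
  have multiplier: "\<exists>v Q R. u = adjoint A v \<and> (\<forall>w. blinfun_apply Q w = blinfun_apply w b + blinfun_apply (p - R) (adjoint A w)) \<and>
      (\<forall>x s rS y t rT. hS (x, s) \<le> ereal rS \<longrightarrow> hT (y, t) \<le> ereal rT \<longrightarrow>
        (blinfun_apply (c + u) x + blinfun_apply R s - rS) + (blinfun_apply (a + v) y + blinfun_apply Q t - rT)
          \<le> M + blinfun_apply v b + blinfun_apply Q a + blinfun_apply R c)"
    if M: "\<And>x v r. ((x, v), r) \<in> H \<Longrightarrow> blinfun_apply u x + blinfun_apply p v - r \<le> M" for u p M
  proof -
    have le: "blinfun_apply u (x1 + x2) + blinfun_apply p (adjoint A w) - (rS - blinfun_apply c x1 + rT - blinfun_apply w b - blinfun_apply a (blinfun_apply A x2) - blinfun_apply a b) \<le> M"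
      if "hS (x1, c + adjoint A w) \<le> ereal rS" "hT (b + A x2, a + w) \<le> ereal rT" for x1 x2 w rS rT
      using M[OF HI[of x1 x2 w rS rT]] that by (simp add: feasible_def val_def)
    show ?thesis by (rule mult[of u p M, OF le]) blast+
  qed
  have conj: "p u \<le> M"
    if M: "\<And>x v r. ((x, v), r) \<in> H \<Longrightarrow> blinfun_apply u x + blinfun_apply p v - r \<le> M" for u p M
  proof -
    obtain v Q R where u: "u = adjoint A v" and Q: "\<And>w. blinfun_apply Q w = blinfun_apply w b + blinfun_apply (p - R) (adjoint A w)"
      and le: "\<And>x s rS y t rT. hS (x, s) \<le> ereal rS \<Longrightarrow> hT (y, t) \<le> ereal rT \<Longrightarrow>
        (blinfun_apply (c + u) x + blinfun_apply R s - rS) + (blinfun_apply (a + v) y + blinfun_apply Q t - rT)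
          \<le> M + blinfun_apply v b + blinfun_apply Q a + blinfun_apply R c"
      using multiplier[OF M] by metis
    \<comment> \<open>Strong representation is used for \<open>hS\<close> with the point of
      \<open>hT\<close> fixed, and then for \<open>hT\<close>.\<close>
    have "Q (a + v) \<le> M + v b + Q a + R c - R (c + u)"
    proof (rule strong_representative_conjugate[OF hT])
      fix y t rT assume yt: "hT (y, t) \<le> ereal rT"
      have "R (c + u) \<le> M + v b + Q a + R c - ((a + v) y + Q t - rT)"
        by (rule strong_representative_conjugate[OF hS]) (use le[OF _ yt] in \<open>simp add: algebra_simps\<close>)
      then show "(a + v) y + Q t - rT \<le> M + v b + Q a + R c - R (c + u)" by simp
    qed
    then show ?thesis using Q[of v] u by (simp add: blinfun.bilinear_simps)
  qed
  have "\<exists>x u. \<forall>y v r. ((y, v), r) \<in> H \<longrightarrow> blinfun_apply u y + blinfun_apply v x - r \<le> blinfun_apply u x"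
    using H_convex H_ge conj by (rule exists_conjugate_le_coupling)
  \<comment> \<open>Writing the inequality with \<open>canon x\<close> puts it in the form that
    \<open>multiplier\<close> accepts, with \<open>p = canon x\<close> and
    \<open>M = u x\<close>.\<close>
  then obtain x u where xu: "blinfun_apply u y + blinfun_apply (canon x) v - r \<le> blinfun_apply u x"
    if "((y, v), r) \<in> H" for y v r
    unfolding canon_apply by blast
  obtain v Q R where u: "u = adjoint A v" and Q: "\<And>w. blinfun_apply Q w = blinfun_apply w b + blinfun_apply (canon x - R) (adjoint A w)"
      and le: "\<And>x' s rS y t rT. hS (x', s) \<le> ereal rS \<Longrightarrow> hT (y, t) \<le> ereal rT \<Longrightarrow>
        (blinfun_apply (c + u) x' + blinfun_apply R s - rS) + (blinfun_apply (a + v) y + blinfun_apply Q t - rT)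
          \<le> blinfun_apply u x + blinfun_apply v b + blinfun_apply Q a + blinfun_apply R c"
    using multiplier[OF xu] by metis
  \<comment> \<open>No slack remains between the joint bound and the two separate ones.\<close>
  have total: "u x + v b + Q a + R c = R (c + u) + Q (a + v)"
    using Q[of v] u by (simp add: blinfun.bilinear_simps)
  have "(R, c + u) \<in> gossez S"
  proof (rule mem_gossezI[OF S])
    fix x' s rS assume xs: "hS (x', s) \<le> ereal rS"
    have "Q (a + v) \<le> R (c + u) + Q (a + v) - ((c + u) x' + R s - rS)"
      by (rule strong_representative_conjugate[OF hT]) (use le[OF xs] total in \<open>simp add: algebra_simps\<close>)
    then show "(c + u) x' + R s - rS \<le> R (c + u)" by simp
  qed
  moreover from this have "R \<in> range canon"
    using dom_closure unfolding dom_op_def by force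
  then obtain x1 where R: "R = canon x1" by blast
  ultimately have S1: "(x1, c + u) \<in> S" using maximal_monotone_gossez[OF S_max] by simp
  \<comment> \<open>Once \<open>R\<close> is canonical, the formula for \<open>Q\<close> makes it
    canonical too and names the point of \<open>Y\<close>.\<close>
  have "Q = canon (b + A (x - x1))"
    by (rule blinfun_eqI) (simp add: Q R blinfun.bilinear_simps)
  moreover have "(Q, a + v) \<in> gossez T"
  proof (rule mem_gossezI[OF T])
    fix y t rT assume yt: "hT (y, t) \<le> ereal rT"
    have "R (c + u) \<le> R (c + u) + Q (a + v) - ((a + v) y + Q t - rT)"
      by (rule strong_representative_conjugate[OF hS]) (use le[OF _ yt] total in \<open>simp add: algebra_simps\<close>)
    then show "(a + v) y + Q t - rT \<le> Q (a + v)" by simp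
  qed
  ultimately have T1: "(b + A (x - x1), a + v) \<in> T" using maximal_monotone_gossez[OF T_max] by simp
  have "c + u \<in> ran_op S" unfolding ran_op_def by (rule image_eqI[OF _ S1]) simp
  moreover have "g = ((b + A (x - x1) - A (x - x1), a + v - v), c + u - adjoint A v)" by (simp add: g u)
  ultimately show "g \<in> msub (T \<times> ran_op S) (E_set A)" unfolding mem_msub_E_set using T1 by blast
qed

text \<open>Split the functional as \<open>(p, q, r)\<close>. Varying the point of
  \<open>E_set A\<close> gives \<open>p o A = 0\<close> and \<open>q w = - r (adjoint A w)\<close>,
  so that the line argument applies to \<open>T\<close> with \<open>(p, q)\<close> and to
  \<open>S\<close> with \<open>(0, r)\<close>.\<close>

lemma functional_constant_on_difference:
  fixes S :: "('a::real_normed_vector \<times> 'a dual) set" and T :: "('b::real_normed_vector \<times> 'b dual) set"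
    and A :: "'a \<Rightarrow>\<^sub>L 'b" and L :: "(('b \<times> 'b dual) \<times> 'a dual) \<Rightarrow>\<^sub>L real"
  assumes S_D: "gossez_D S" and T_D: "gossez_D T" and S: "representative S hS" and T: "representative T hT"
    and const: "\<And>d. d \<in> msub (T \<times> ran_op S) (E_set A) \<Longrightarrow> blinfun_apply L d = \<alpha>"
    and d: "d \<in> msub (edom hT \<times> snd ` edom hS) (E_set A)"
  shows "blinfun_apply L d = \<alpha>"
proof -
  obtain L' r where L': "\<And>z s. L (z, s) = blinfun_apply L' z + blinfun_apply r s"
    using blinfun_prod_split[of L] by metis
  obtain p q where L'': "\<And>y t. L' (y, t) = blinfun_apply p y + blinfun_apply q t"
    using blinfun_prod_split[of L'] by metis
  have "S \<noteq> {}" "T \<noteq> {}" using S_D T_D maximal_monotone_nonempty by (auto simp: gossez_D_def)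
  then obtain x0 s0 y0 t0 where S0: "(x0, s0) \<in> S" and T0: "(y0, t0) \<in> T" by auto
  have const': "p (y - A x) + q (t - w) + r (s - adjoint A w) = \<alpha>"
    if "(y, t) \<in> T" "(x', s) \<in> S" for y t s x w x'
  proof -
    have "s \<in> ran_op S" unfolding ran_op_def by (rule image_eqI[OF _ that(2)]) simp
    then have "((y - A x, t - w), s - adjoint A w) \<in> msub (T \<times> ran_op S) (E_set A)"
      unfolding mem_msub_E_set using that(1) by blast
    from const[OF this] show ?thesis by (simp add: L' L'')
  qed
  have adj0: "adjoint A 0 = 0" by (rule blinfun_eqI) simp
  have const0: "p y + q t + r s = \<alpha>" if "(y, t) \<in> T" "(x', s) \<in> S" for y t s x'
    using const'[OF that, of 0 0] by (simp add: adj0)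
  have pA: "p (A x) = 0" for x
    using const'[OF T0 S0, of x 0] const0[OF T0 S0] by (simp add: adj0 blinfun.bilinear_simps)
  have qr: "q w + r (adjoint A w) = 0" for w
    using const'[OF T0 S0, of 0 w] const0[OF T0 S0] by (simp add: blinfun.bilinear_simps)
  \<comment> \<open>Taking \<open>w = p\<close> in \<open>qr\<close> turns this into
    \<open>q p = 0\<close>.\<close>
  have "adjoint A p = 0" by (rule blinfun_eqI) (simp add: pA)
  with qr[of p] have qp: "q p = 0" by simp
  obtain y t x1 s x w where yt: "(y, t) \<in> edom hT" and xs: "(x1, s) \<in> edom hS"
    and d_eq: "d = ((y - A x, t - w), s - adjoint A w)"
    using d unfolding mem_msub_E_set by fastforce
  have "p y + q t = \<alpha> - r s0"
    using const0[OF _ S0] by (intro functional_constant_on_edom[OF T_D T _ qp yt]) (simp add: algebra_simps)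
  moreover have "(0 :: 'a dual) x1 + r s = \<alpha> - (p y0 + q t0)"
    using const0[OF T0] by (intro functional_constant_on_edom[OF S_D S _ _ xs]) (simp_all add: algebra_simps)
  ultimately have "p y + q t + r s = \<alpha>" using const0[OF T0 S0] by simp
  then show ?thesis using pA[of x] qr[of w] by (simp add: d_eq L' L'' blinfun.bilinear_simps)
qed

section \<open>Equality of the six cores and relative interiors\<close>

theorem theorem3p6:
  fixes S :: "('a::banach \<times> 'a dual) set" and T :: "('b::banach \<times> 'b dual) set"
    and hS :: "'a \<times> 'a dual \<Rightarrow> ereal" and hT :: "'b \<times> 'b dual \<Rightarrow> ereal"
    and A :: "'a \<Rightarrow>\<^sub>L 'b"
  assumes X_nonzero: "(UNIV :: 'a set) \<noteq> {0}"
    and Y_nonzero: "(UNIV :: 'b set) \<noteq> {0}"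
    and S_D: "gossez_D S" and T_D: "gossez_D T"
    and hS: "strong_representative S hS" and hT: "strong_representative T hT"
    and qual: "(edom hT \<times> snd ` edom hS) \<inter> E_set A \<noteq> {}"
    and dom_closure: "dom_op (gossez S) \<subseteq> range canon"
  shows "ic (msub (T \<times> ran_op S) (E_set A)) = ri (msub (T \<times> ran_op S) (E_set A))
       \<and> ri (msub (T \<times> ran_op S) (E_set A))
           = ic (msub ((convex hull T) \<times> (convex hull (ran_op S))) (E_set A))
       \<and> ic (msub ((convex hull T) \<times> (convex hull (ran_op S))) (E_set A))
           = ri (msub ((convex hull T) \<times> (convex hull (ran_op S))) (E_set A))
       \<and> ri (msub ((convex hull T) \<times> (convex hull (ran_op S))) (E_set A))
           = ic (msub (edom hT \<times> snd ` edom hS) (E_set A))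
       \<and> ic (msub (edom hT \<times> snd ` edom hS) (E_set A))
           = ri (msub (edom hT \<times> snd ` edom hS) (E_set A))"
proof -
  define D1 where "D1 = msub (T \<times> ran_op S) (E_set A)"
  define D2 where "D2 = msub ((convex hull T) \<times> (convex hull (ran_op S))) (E_set A)"
  define D3 where "D3 = msub (edom hT \<times> snd ` edom hS) (E_set A)"
  have S: "representative S hS" and T: "representative T hT"
    using hS hT by (simp_all add: strong_representative_def)
  have S_max: "maximal_monotone S" and T_max: "maximal_monotone T"
    using S_D T_D by (simp_all add: gossez_D_def)
  \<comment> \<open>Writing the domain as a projection of the epigraph transfers convexity to
    it.\<close>
  have edom_eq: "edom h = fst ` {(z, r::real). h z \<le> ereal r}" for h :: "'c \<Rightarrow> ereal"
    by (force simp: mem_edom)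
  have "convex (edom hT)" "convex (edom hS)"
    unfolding edom_eq using representative_epigraph(1)[OF S] representative_epigraph(1)[OF T]
    by (auto intro: convex_linear_image linear_fst)
  then have conv: "convex (edom hT)" "convex (snd ` edom hS)"
    by (auto intro: convex_linear_image linear_snd)
  have sub_edom: "S \<subseteq> edom hS" "T \<subseteq> edom hT"
    using S T by (auto simp: representative_def edom_def)
  have sub12: "D1 \<subseteq> D2"
    unfolding D1_def D2_def msub_def using hull_subset[of T convex] hull_subset[of "ran_op S" convex] by blast
  have "convex hull T \<subseteq> edom hT" "convex hull (ran_op S) \<subseteq> snd ` edom hS"
    unfolding ran_op_def by (intro hull_minimal image_mono conv sub_edom)+
  then have sub23: "D2 \<subseteq> D3" unfolding D2_def D3_def msub_def by blast
  have "S \<noteq> {}" "T \<noteq> {}" using S_max T_max maximal_monotone_nonempty by auto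
  then obtain y t x s where "(y, t) \<in> T" "(x, s) \<in> S" by auto
  then have "((y, t), s) \<in> T \<times> ran_op S" by (force simp: ran_op_def)
  moreover have "((A 0, 0), adjoint A 0) \<in> E_set A" unfolding E_set_def by blast
  ultimately have ne: "D1 \<noteq> {}" unfolding D1_def msub_def by blast
  then have ne3: "D3 \<noteq> {}" using sub12 sub23 by blast
  \<comment> \<open>Stated for every intermediate \<open>D\<close>, so that one argument covers
    \<open>D1\<close>, \<open>D2\<close> and \<open>D3\<close>; all six sets are then compared with
    \<open>ic D3\<close>.\<close>
  have hull: "affine hull D = affine hull D3" if "closed (affine hull D)" "D1 \<subseteq> D" "D \<subseteq> D3" for D
    by (rule affine_hull_eq_of_functionals[OF ne that(2,3,1)])
      (rule functional_constant_on_difference[OF S_D T_D S T], auto simp: D1_def D3_def)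
  have core: "icr D3 \<subseteq> D1 \<inter> rel_interior D3" if "closed (affine hull D3)"
    using icr_subset_operator_difference[OF S_max T_max hS hT dom_closure, of A]
      icr_subset_rel_interior[OF S T, of A] that ne3
    unfolding D1_def D3_def by blast
  have "ic D = ic D3 \<and> ri D = ic D3" if "D1 \<subseteq> D" "D \<subseteq> D3" for D
    using ic_ri_sandwich[OF ne that hull[OF _ that] core] by blast
  then have "ic D1 = ic D3" "ri D1 = ic D3" "ic D2 = ic D3" "ri D2 = ic D3" "ri D3 = ic D3"
    using sub12 sub23 by blast+
  then show ?thesis unfolding D1_def[symmetric] D2_def[symmetric] D3_def[symmetric] by simp
qed

end
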